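(* Let $G$ be a connected graph that has no quantum symmetry. Then $2G$, the disjoint union of two copies of $G$, has no nonlocal symmetry.
   Context: Graphs are finite and simple, with adjacency matrix $A_G$. For a graph $G$, $C(\mathrm{Qut}(G))$ is the universal unital $C^*$-algebra generated by $u_{ij}$, $i,j\in V(G)$, subject to $u_{ij}=u_{ij}^*=u_{ij}^2$, $\sum_ku_{ik}=\mathbf 1=\sum_ku_{ki}$ and $UA_G=A_GU$, where $U=(u_{ij})$. $G$ has no quantum symmetry if $C(\mathrm{Qut}(G))$ is commutative. In the $G$-automorphism game Alice and Bob receive vertices $i,j\in V(G)$ and answer with vertices $l,k\in V(G)$ respectively (without communicating); they win iff $\mathrm{rel}(i,j)=\mathrm{rel}(l,k)$, where $\mathrm{rel}$ records whether two vertices are equal, distinct and adjacent, or distinct and non-adjacent. A correlation is a function $p:V(G)^4\to[0,1]$, written $p(l,k|i,j)$, with $\sum_{l,k}p(l,k|i,j)=1$ for all $i,j$; it is winning if $p(l,k|i,j)=0$ whenever $\mathrm{rel}(i,j)\ne\mathrm{rel}(l,k)$. The winning classical correlations are the convex combinations of the correlations $p_\pi$, $\pi\in\mathrm{Aut}(G)$, where $p_\pi(l,k|i,j)=1$ if $l=\pi(i)$, $k=\pi(j)$ and $0$ otherwise. A quantum correlation is one of the form $p(l,k|i,j)=\psi^*M_{il}N_{jk}\psi$ with $\psi$ a unit vector in a Hilbert space $\mathcal H$ and $M_{il},N_{jk}\in B(\mathcal H)$ positive semidefinite, $\sum_lM_{il}=\mathbf 1=\sum_kN_{jk}$, and $M_{il}N_{jk}=N_{jk}M_{il}$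 for all indices. $G$ has nonlocal symmetry if there is a winning quantum correlation for the $G$-automorphism game that is not classical. It is known that the winning quantum correlations of this game are exactly $p(l,k|i,j)=\tau(u_{il}u_{jk})$ for tracial states $\tau$ on $C(\mathrm{Qut}(G))$. *)

theory Defs
  imports
    "HOL-Analysis.Analysis"
    "HOL-Library.Poly_Mapping"
    "HOL-Algebra.Module"
begin

section \<open>Graphs\<close>

text \<open>
  A graph has a finite type as its vertex set and is given by its adjacency relation.
\<close>

definition simple_graph :: "('v::finite \<Rightarrow> 'v \<Rightarrow> bool) \<Rightarrow> bool" where
  "simple_graph E \<longleftrightarrow> symp E \<and> irreflp E"

definition connected_graph :: "('v::finite \<Rightarrow> 'v \<Rightarrow> bool) \<Rightarrow> bool" where
  "connected_graph E \<longleftrightarrow> (\<forall>x y. E\<^sup>*\<^sup>* x y)"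

definition adj_matrix :: "('v::finite \<Rightarrow> 'v \<Rightarrow> bool) \<Rightarrow> 'v \<Rightarrow> 'v \<Rightarrow> 'a::zero_neq_one" where
  "adj_matrix E i j = (if E i j then 1 else 0)"

definition graph_aut :: "('v::finite \<Rightarrow> 'v \<Rightarrow> bool) \<Rightarrow> ('v \<Rightarrow> 'v) set" where
  "graph_aut E = {\<pi>. bij \<pi> \<and> (\<forall>x y. E (\<pi> x) (\<pi> y) \<longleftrightarrow> E x y)}"

fun disjoint_union ::
  "('v::finite \<Rightarrow> 'v \<Rightarrow> bool) \<Rightarrow> ('w::finite \<Rightarrow> 'w \<Rightarrow> bool) \<Rightarrow> 'v + 'w \<Rightarrow> 'v + 'w \<Rightarrow> bool"
where
  "disjoint_union E F (Inl x) (Inl y) = E x y"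
| "disjoint_union E F (Inr x) (Inr y) = F x y"
| "disjoint_union E F (Inl x) (Inr y) = False"
| "disjoint_union E F (Inr x) (Inl y) = False"

definition two_copies :: "('v::finite \<Rightarrow> 'v \<Rightarrow> bool) \<Rightarrow> 'v + 'v \<Rightarrow> 'v + 'v \<Rightarrow> bool" where
  "two_copies E = disjoint_union E E"


section \<open>The free unital *-algebra\<close>

datatype 'x letter = Gen 'x | Gen_adj 'x

datatype 'x word = Word (letters: "'x letter list")

text \<open>
  Words form a monoid under concatenation, written additively because \<open>poly_mapping\<close>
  multiplies by convolution over an additive monoid.  Hence \<open>'x word \<Rightarrow>\<^sub>0 complex\<close> is the
  algebra of noncommutative polynomials in the generators and their formal adjoints.
\<close>

instantiation word :: (type) monoid_add
begin

definition zero_word :: "'a word" where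
  "0 = Word []"

definition plus_word :: "'a word \<Rightarrow> 'a word \<Rightarrow> 'a word" where
  "v + w = Word (letters v @ letters w)"

instance
  by standard (simp_all add: zero_word_def plus_word_def)

end

type_synonym 'x ncpoly = "'x word \<Rightarrow>\<^sub>0 complex"

fun letter_adj :: "'x letter \<Rightarrow> 'x letter" where
  "letter_adj (Gen x) = Gen_adj x"
| "letter_adj (Gen_adj x) = Gen x"

definition word_adj :: "'x word \<Rightarrow> 'x word" where
  "word_adj w = Word (map letter_adj (rev (letters w)))"

definition nc_gen :: "'x \<Rightarrow> 'x ncpoly" where
  "nc_gen x = Poly_Mapping.single (Word [Gen x]) 1"

definition nc_adj :: "'x ncpoly \<Rightarrow> 'x ncpoly" where
  "nc_adj f = (\<Sum>w\<in>Poly_Mapping.keys f.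
     Poly_Mapping.single (word_adj w) (cnj (Poly_Mapping.lookup f w)))"

definition nc_scale :: "complex \<Rightarrow> 'x ncpoly \<Rightarrow> 'x ncpoly" where
  "nc_scale c f = Poly_Mapping.single 0 c * f"


section \<open>The universal unital C*-algebra of generators and relations\<close>

definition cstar_seminorm :: "('x ncpoly \<Rightarrow> real) \<Rightarrow> bool" where
  "cstar_seminorm p \<longleftrightarrow>
     (\<forall>f. 0 \<le> p f) \<and>
     (\<forall>f g. p (f + g) \<le> p f + p g) \<and>
     (\<forall>c f. p (nc_scale c f) = cmod c * p f) \<and>
     (\<forall>f g. p (f * g) \<le> p f * p g) \<and>
     (\<forall>f. p (nc_adj f * f) = (p f)\<^sup>2)"

text \<open>
  A C*-seminorm vanishes on the relators \<open>R\<close> iff it vanishes on the *-ideal they generate, so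
  these are the C*-seminorms of the quotient *-algebra.
\<close>

definition admissible_seminorms :: "'x ncpoly set \<Rightarrow> ('x ncpoly \<Rightarrow> real) set" where
  "admissible_seminorms R = {p. cstar_seminorm p \<and> (\<forall>r\<in>R. p r = 0)}"

text \<open>
  The supremum is meaningful only for relators that bound the seminorms pointwise; for the quantum
  automorphism group this is lemma \<open>bdd_above_qut_seminorms\<close> below.
\<close>

definition universal_seminorm :: "'x ncpoly set \<Rightarrow> 'x ncpoly \<Rightarrow> real" where
  "universal_seminorm R f = (SUP p\<in>admissible_seminorms R. p f)"

text \<open>
  The separated completion: Cauchy sequences of noncommutative polynomials modulo null
  sequences.
\<close>

definition nc_Cauchy :: "'x ncpoly set \<Rightarrow> (nat \<Rightarrow> 'x ncpoly) set" where
  "nc_Cauchy R = {s. \<forall>e>0. \<exists>N. \<forall>m\<ge>N. \<forall>n\<ge>N. universal_seminorm R (s m - s n) < e}"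

definition nc_null_rel :: "'x ncpoly set \<Rightarrow> ((nat \<Rightarrow> 'x ncpoly) \<times> (nat \<Rightarrow> 'x ncpoly)) set" where
  "nc_null_rel R = {(s, t). s \<in> nc_Cauchy R \<and> t \<in> nc_Cauchy R \<and>
     (\<lambda>n. universal_seminorm R (s n - t n)) \<longlonglongrightarrow> 0}"

definition nc_class :: "'x ncpoly set \<Rightarrow> (nat \<Rightarrow> 'x ncpoly) \<Rightarrow> (nat \<Rightarrow> 'x ncpoly) set" where
  "nc_class R s = nc_null_rel R `` {s}"

record 'a cstar_structure = "(complex, 'a) module" +
  involution :: "'a \<Rightarrow> 'a"
  cstar_norm :: "'a \<Rightarrow> real"

definition universal_cstar_algebra ::
  "'x ncpoly set \<Rightarrow> (nat \<Rightarrow> 'x ncpoly) set cstar_structure"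
where
  "universal_cstar_algebra R =
     \<lparr>carrier = nc_Cauchy R // nc_null_rel R,
      mult = (\<lambda>X Y. \<Union>s\<in>X. \<Union>t\<in>Y. nc_class R (\<lambda>n. s n * t n)),
      one = nc_class R (\<lambda>n. 1),
      zero = nc_class R (\<lambda>n. 0),
      add = (\<lambda>X Y. \<Union>s\<in>X. \<Union>t\<in>Y. nc_class R (\<lambda>n. s n + t n)),
      smult = (\<lambda>c X. \<Union>s\<in>X. nc_class R (\<lambda>n. nc_scale c (s n))),
      involution = (\<lambda>X. \<Union>s\<in>X. nc_class R (\<lambda>n. nc_adj (s n))),
      cstar_norm = (\<lambda>X. the_elem ((\<lambda>s. lim (\<lambda>n. universal_seminorm R (s n))) ` X))\<rparr>"


section \<open>The quantum automorphism group\<close>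

abbreviation qut_gen :: "'v \<Rightarrow> 'v \<Rightarrow> ('v \<times> 'v) ncpoly" where
  "qut_gen i j \<equiv> nc_gen (i, j)"

text \<open>
  The differences of the two sides of the relations \<open>u\<^sub>i\<^sub>j = u\<^sub>i\<^sub>j\<^sup>*\<close>, \<open>u\<^sub>i\<^sub>j = u\<^sub>i\<^sub>j\<^sup>2\<close>, the
  row and column sums, and the entries of \<open>U A = A U\<close>.
\<close>

definition qut_relators :: "('v::finite \<Rightarrow> 'v \<Rightarrow> bool) \<Rightarrow> ('v \<times> 'v) ncpoly set" where
  "qut_relators E =
     {qut_gen i j - nc_adj (qut_gen i j) | i j. True} \<union>
     {qut_gen i j - qut_gen i j * qut_gen i j | i j. True} \<union>
     {(\<Sum>k\<in>UNIV. qut_gen i k) - 1 | i. True} \<union>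
     {(\<Sum>k\<in>UNIV. qut_gen k i) - 1 | i. True} \<union>
     {(\<Sum>k\<in>UNIV. qut_gen i k * adj_matrix E k j) -
      (\<Sum>k\<in>UNIV. adj_matrix E i k * qut_gen k j) | i j. True}"

definition C_Qut ::
  "('v::finite \<Rightarrow> 'v \<Rightarrow> bool) \<Rightarrow> (nat \<Rightarrow> ('v \<times> 'v) ncpoly) set cstar_structure"
where
  "C_Qut E = universal_cstar_algebra (qut_relators E)"

definition no_quantum_symmetry :: "('v::finite \<Rightarrow> 'v \<Rightarrow> bool) \<Rightarrow> bool" where
  "no_quantum_symmetry E \<longleftrightarrow>
     (\<forall>x\<in>carrier (C_Qut E). \<forall>y\<in>carrier (C_Qut E). x \<otimes>\<^bsub>C_Qut E\<^esub> y = y \<otimes>\<^bsub>C_Qut E\<^esub> x)"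

lemma word_adj_0 [simp]: "word_adj 0 = 0"
  by (simp add: word_adj_def zero_word_def)

lemma nc_adj_single: "nc_adj (Poly_Mapping.single w c) = Poly_Mapping.single (word_adj w) (cnj c)"
  by (simp add: nc_adj_def)

lemma cstar_seminorm_diff_eq:
  assumes p: "cstar_seminorm p" and z: "p (f - g) = 0"
  shows "p f = p g"
proof -
  have "g - f = nc_scale (- 1) (f - g)"
    by (simp add: nc_scale_def single_uminus)
  then have z': "p (g - f) = 0"
    using p z by (simp add: cstar_seminorm_def)
  have "p (g + (f - g)) \<le> p g + p (f - g)" "p (f + (g - f)) \<le> p f + p (g - f)"
    using p unfolding cstar_seminorm_def by blast+
  with z z' show ?thesis
    by simp
qed

lemma qut_seminorm_gen_le_1:
  assumes "p \<in> admissible_seminorms (qut_relators E)"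
  shows "p 1 \<le> 1" "p (qut_gen i j) \<le> 1" "p (nc_adj (qut_gen i j)) \<le> 1"
proof -
  let ?u = "qut_gen i j"
  from assms have p: "cstar_seminorm p" and R: "\<And>r. r \<in> qut_relators E \<Longrightarrow> p r = 0"
    by (auto simp: admissible_seminorms_def)
  have idem: "x \<le> 1" if "x = x\<^sup>2" for x :: real
    using that by (auto simp: power2_eq_square)
  have sq: "p (nc_adj f * f) = (p f)\<^sup>2" and sub: "p (f * g) \<le> p f * p g" and nn: "0 \<le> p f"
    for f g
    using p by (auto simp: cstar_seminorm_def)
  have "nc_adj 1 = (1 :: ('a \<times> 'a) ncpoly)"
    by (metis complex_cnj_one nc_adj_single single_one word_adj_0)
  then show "p 1 \<le> 1"
    using sq[of 1] by (intro idem) simp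
  have sa: "p (?u - nc_adj ?u) = 0" and id: "p (?u - ?u * ?u) = 0"
    by (rule R; force simp: qut_relators_def)+
  have "p ((?u - nc_adj ?u) * ?u) \<le> 0"
    using sub[of "?u - nc_adj ?u" ?u] sa by simp
  then have "p (?u * ?u - nc_adj ?u * ?u) = 0"
    using nn[of "(?u - nc_adj ?u) * ?u"] by (simp add: left_diff_distrib)
  then have "p ?u = (p ?u)\<^sup>2"
    using cstar_seminorm_diff_eq[OF p] id sq by metis
  then show u: "p ?u \<le> 1"
    by (rule idem)
  then show "p (nc_adj ?u) \<le> 1"
    using cstar_seminorm_diff_eq[OF p sa] by simp
qed

lemma qut_seminorm_word_le_1:
  assumes "p \<in> admissible_seminorms (qut_relators E)"
  shows "p (Poly_Mapping.single (Word ls) 1) \<le> 1"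
proof (induction ls)
  case Nil
  then show ?case
    using qut_seminorm_gen_le_1(1)[OF assms] by (metis single_one zero_word_def)
next
  case (Cons l ls)
  from assms have p: "cstar_seminorm p"
    by (simp add: admissible_seminorms_def)
  obtain x where "l = Gen x \<or> l = Gen_adj x"
    by (cases l) auto
  moreover obtain i j where "x = (i, j)"
    by (cases x)
  ultimately have l: "p (Poly_Mapping.single (Word [l]) 1) \<le> 1"
    using qut_seminorm_gen_le_1(2,3)[OF assms, of i j]
    by (auto simp: nc_gen_def nc_adj_single word_adj_def)
  have "Poly_Mapping.single (Word (l # ls)) (1::complex) =
      Poly_Mapping.single (Word [l]) 1 * Poly_Mapping.single (Word ls) 1"
    by (simp add: mult_single plus_word_def)
  then have "p (Poly_Mapping.single (Word (l # ls)) 1) \<le>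
      p (Poly_Mapping.single (Word [l]) 1) * p (Poly_Mapping.single (Word ls) 1)"
    using p by (simp add: cstar_seminorm_def)
  also have "\<dots> \<le> 1"
    using l Cons.IH p by (simp add: cstar_seminorm_def mult_le_one)
  finally show ?case .
qed

lemma bdd_above_qut_seminorms:
  "bdd_above ((\<lambda>p. p f) ` admissible_seminorms (qut_relators E))"
proof (intro bdd_aboveI2)
  fix p assume a: "p \<in> admissible_seminorms (qut_relators E)"
  then have p: "cstar_seminorm p"
    by (simp add: admissible_seminorms_def)
  have p0: "p 0 = 0"
  proof -
    have "p (nc_scale 0 0) = cmod 0 * p 0"
      using p unfolding cstar_seminorm_def by blast
    then show ?thesis
      by (simp add: nc_scale_def)
  qed
  have sum_le: "p (\<Sum>w\<in>A. g w) \<le> (\<Sum>w\<in>A. p (g w))" if "finite A"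
    for A :: "('a \<times> 'a) word set" and g
    using that
  proof (induction A)
    case (insert w A)
    have "p (g w + sum g A) \<le> p (g w) + p (sum g A)"
      using p unfolding cstar_seminorm_def by blast
    with insert show ?case
      by simp
  qed (simp add: p0)
  have term_le: "p (Poly_Mapping.single w c) \<le> cmod c" for w c
  proof -
    have "Poly_Mapping.single w c = nc_scale c (Poly_Mapping.single w 1)"
      by (simp add: nc_scale_def mult_single)
    then have "p (Poly_Mapping.single w c) = cmod c * p (Poly_Mapping.single w 1)"
      using p by (simp add: cstar_seminorm_def)
    also have "\<dots> \<le> cmod c * 1"
      using qut_seminorm_word_le_1[OF a, of "letters w"] by (intro mult_left_mono) auto
    finally show ?thesis
      by simp
  qed
  have "f = (\<Sum>w\<in>Poly_Mapping.keys f. Poly_Mapping.single w (Poly_Mapping.lookup f w))"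
    by (rule poly_mapping_eqI) (auto simp: lookup_sum lookup_single when_def in_keys_iff)
  then have "p f \<le> (\<Sum>w\<in>Poly_Mapping.keys f.
      p (Poly_Mapping.single w (Poly_Mapping.lookup f w)))"
    using sum_le[OF finite_keys] by metis
  also have "\<dots> \<le> (\<Sum>w\<in>Poly_Mapping.keys f. cmod (Poly_Mapping.lookup f w))"
    by (intro sum_mono term_le)
  finally show "p f \<le> (\<Sum>w\<in>Poly_Mapping.keys f. cmod (Poly_Mapping.lookup f w))" .
qed


section \<open>Complex Hilbert spaces\<close>

text \<open>The inner product is linear in the second argument.\<close>

class complex_hilbert = banach +
  fixes cscale :: "complex \<Rightarrow> 'a \<Rightarrow> 'a"
    and cinner :: "'a \<Rightarrow> 'a \<Rightarrow> complex"
  assumes cscale_add_right: "cscale c (x + y) = cscale c x + cscale c y"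
    and cscale_add_left: "cscale (c + d) x = cscale c x + cscale d x"
    and cscale_cscale: "cscale c (cscale d x) = cscale (c * d) x"
    and cscale_of_real: "cscale (complex_of_real r) x = r *\<^sub>R x"
    and cinner_commute: "cinner x y = cnj (cinner y x)"
    and cinner_add_right: "cinner x (y + z) = cinner x y + cinner x z"
    and cinner_cscale_right: "cinner x (cscale c y) = c * cinner x y"
    and cinner_self: "cinner x x = complex_of_real ((norm x)\<^sup>2)"

instantiation complex :: complex_hilbert
begin

definition cscale_complex :: "complex \<Rightarrow> complex \<Rightarrow> complex" where
  "cscale c x = c * x"

definition cinner_complex :: "complex \<Rightarrow> complex \<Rightarrow> complex" where
  "cinner x y = cnj x * y"

instance
proof
  fix x :: complex
  show "cinner x x = complex_of_real ((norm x)\<^sup>2)"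
    unfolding cinner_complex_def complex_norm_square by (rule mult.commute)
qed (simp_all add: cscale_complex_def cinner_complex_def algebra_simps scaleR_conv_of_real)

end

definition bounded_operator :: "('h::complex_hilbert \<Rightarrow> 'h) \<Rightarrow> bool" where
  "bounded_operator T \<longleftrightarrow> bounded_linear T \<and> (\<forall>c x. T (cscale c x) = cscale c (T x))"

definition positive_operator :: "('h::complex_hilbert \<Rightarrow> 'h) \<Rightarrow> bool" where
  "positive_operator T \<longleftrightarrow> bounded_operator T \<and> (\<forall>x. cinner x (T x) \<in> \<real>\<^sub>\<ge>\<^sub>0)"


section \<open>The graph automorphism game\<close>

datatype vertex_rel = Equal | Adjacent | Nonadjacent

definition vrel :: "('v::finite \<Rightarrow> 'v \<Rightarrow> bool) \<Rightarrow> 'v \<Rightarrow> 'v \<Rightarrow> vertex_rel" where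
  "vrel E i j = (if i = j then Equal else if E i j then Adjacent else Nonadjacent)"

text \<open>The argument order of \<open>p l k i j\<close> is that of \<open>p(l,k|i,j)\<close>: answers first.\<close>

type_synonym 'v correlation = "'v \<Rightarrow> 'v \<Rightarrow> 'v \<Rightarrow> 'v \<Rightarrow> real"

definition is_correlation :: "'v::finite correlation \<Rightarrow> bool" where
  "is_correlation p \<longleftrightarrow>
     (\<forall>l k i j. 0 \<le> p l k i j \<and> p l k i j \<le> 1) \<and>
     (\<forall>i j. (\<Sum>l\<in>UNIV. \<Sum>k\<in>UNIV. p l k i j) = 1)"

definition winning :: "('v::finite \<Rightarrow> 'v \<Rightarrow> bool) \<Rightarrow> 'v correlation \<Rightarrow> bool" where
  "winning E p \<longleftrightarrow> (\<forall>l k i j. vrel E i j \<noteq> vrel E l k \<longrightarrow> p l k i j = 0)"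

definition aut_correlation :: "('v::finite \<Rightarrow> 'v) \<Rightarrow> 'v correlation" where
  "aut_correlation \<pi> l k i j = (if l = \<pi> i \<and> k = \<pi> j then 1 else 0)"

definition winning_classical :: "('v::finite \<Rightarrow> 'v \<Rightarrow> bool) \<Rightarrow> 'v correlation \<Rightarrow> bool" where
  "winning_classical E p \<longleftrightarrow>
     (\<exists>c. (\<forall>\<pi>\<in>graph_aut E. 0 \<le> c \<pi>) \<and> (\<Sum>\<pi>\<in>graph_aut E. c \<pi>) = 1 \<and>
          (\<forall>l k i j. p l k i j = (\<Sum>\<pi>\<in>graph_aut E. c \<pi> * aut_correlation \<pi> l k i j)))"

text \<open>
  The type argument is the Hilbert space.  HOL cannot quantify over types inside a formula, so
  \<open>nonlocal_symmetry_on\<close> refers to correlations realised on one given Hilbert space; a graph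
  has no nonlocal symmetry iff this fails for every Hilbert space type.
\<close>

definition quantum_correlation ::
  "'h::complex_hilbert itself \<Rightarrow> 'v::finite correlation \<Rightarrow> bool"
where
  "quantum_correlation _ p \<longleftrightarrow>
     is_correlation p \<and>
     (\<exists>(\<psi>::'h) (M :: 'v \<Rightarrow> 'v \<Rightarrow> 'h \<Rightarrow> 'h) (N :: 'v \<Rightarrow> 'v \<Rightarrow> 'h \<Rightarrow> 'h).
        norm \<psi> = 1 \<and>
        (\<forall>i l. positive_operator (M i l)) \<and>
        (\<forall>j k. positive_operator (N j k)) \<and>
        (\<forall>i x. (\<Sum>l\<in>UNIV. M i l x) = x) \<and>
        (\<forall>j x. (\<Sum>k\<in>UNIV. N j k x) = x) \<and>
        (\<forall>i l j k. M i l \<circ> N j k = N j k \<circ> M i l) \<and>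
        (\<forall>l k i j. complex_of_real (p l k i j) = cinner \<psi> (M i l (N j k \<psi>))))"

definition nonlocal_symmetry_on ::
  "'h::complex_hilbert itself \<Rightarrow> ('v::finite \<Rightarrow> 'v \<Rightarrow> bool) \<Rightarrow> bool"
where
  "nonlocal_symmetry_on H E \<longleftrightarrow>
     (\<exists>p. quantum_correlation H p \<and> winning E p \<and> \<not> winning_classical E p)"

end

theory Submission
  imports Defs
begin

text \<open>
  In a winning strategy \<open>M i l \<psi> = N i l \<psi>\<close>.  Hence on the space obtained by applying the commutant
  of the \<open>M i l\<close> to \<open>\<psi>\<close> these operators satisfy the relations of the quantum automorphism group of
  \<open>2G\<close>, and \<open>\<psi>\<close> is a tracial state on the algebra they generate.  As \<open>G\<close> is connected, the copy
  to which a vertex is sent depends only on the copy containing it; so, for each copy, forgetting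
  the copy of the answer gives a representation of the quantum automorphism group of \<open>G\<close>.  Since
  \<open>G\<close> has no quantum symmetry, all operators belonging to questions from the same copy commute.
  For a map \<open>\<sigma>\<close> on the vertices, the product of all \<open>M i (\<sigma> i)\<close> over one copy is then a projection,
  and the trace of the product of the two projections for the two copies is a nonnegative weight
  on \<open>\<sigma>\<close>, zero unless \<open>\<sigma>\<close> is an automorphism.  Operators from different copies need not commute,
  but a correlation involves only two questions, so summing these weights recovers it.
\<close>

section \<open>Hilbert space preliminaries\<close>

lemma cscale_zero_left [simp]: "cscale 0 (x :: 'a::complex_hilbert) = 0"
  using cscale_of_real[of 0 x] by simp

lemma cscale_one [simp]: "cscale 1 (x :: 'a::complex_hilbert) = x"
  using cscale_of_real[of 1 x] by simp

lemma cscale_zero_right [simp]: "cscale c (0 :: 'a::complex_hilbert) = 0"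
  using cscale_add_right[of c "0::'a" 0] by simp

lemma cscale_minus_one [simp]: "cscale (- 1) (x :: 'a::complex_hilbert) = - x"
  using cscale_of_real[of "- 1" x] by simp

lemma cinner_zero_right [simp]: "cinner (x :: 'a::complex_hilbert) 0 = 0"
  using cinner_add_right[of x 0 0] by simp

lemma cinner_add_left: "cinner (x + y :: 'a::complex_hilbert) z = cinner x z + cinner y z"
  by (metis cinner_add_right cinner_commute complex_cnj_add)

lemma cinner_cscale_left: "cinner (cscale c (x :: 'a::complex_hilbert)) y = cnj c * cinner x y"
  by (metis cinner_commute cinner_cscale_right complex_cnj_mult)

lemma cinner_zero_left [simp]: "cinner 0 (x :: 'a::complex_hilbert) = 0"
  using cinner_add_left[of 0 0 x] by simp

lemma cinner_minus_right: "cinner (x :: 'a::complex_hilbert) (- y) = - cinner x y"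
  using cinner_cscale_right[of x "- 1" y] by simp

lemma cinner_minus_left: "cinner (- x :: 'a::complex_hilbert) y = - cinner x y"
  using cinner_cscale_left[of "- 1" x y] by simp

lemma cinner_diff_right: "cinner (x :: 'a::complex_hilbert) (y - z) = cinner x y - cinner x z"
  using cinner_add_right[of x y "- z"] by (simp add: cinner_minus_right)

lemma cinner_diff_left: "cinner (x - y :: 'a::complex_hilbert) z = cinner x z - cinner y z"
  using cinner_add_left[of x "- y" z] by (simp add: cinner_minus_left)

lemma cinner_sum_right: "cinner (x :: 'a::complex_hilbert) (sum f A) = (\<Sum>a\<in>A. cinner x (f a))"
  by (induction A rule: infinite_finite_induct) (simp_all add: cinner_add_right)

lemma cinner_sum_left: "cinner (sum f A) (x :: 'a::complex_hilbert) = (\<Sum>a\<in>A. cinner (f a) x)"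
  by (induction A rule: infinite_finite_induct) (simp_all add: cinner_add_left)

lemma Re_cinner_commute: "Re (cinner (x :: 'a::complex_hilbert) y) = Re (cinner y x)"
  by (subst cinner_commute) simp

lemma cinner_self_eq_0 [simp]: "cinner (x :: 'a::complex_hilbert) x = 0 \<longleftrightarrow> x = 0"
  by (simp add: cinner_self)

lemma norm_cscale [simp]: "norm (cscale c (x :: 'a::complex_hilbert)) = cmod c * norm x"
proof -
  have "complex_of_real ((norm (cscale c x))\<^sup>2) = (c * cnj c) * complex_of_real ((norm x)\<^sup>2)"
    unfolding cinner_self[symmetric] by (simp add: cinner_cscale_left cinner_cscale_right)
  also have "\<dots> = complex_of_real ((cmod c * norm x)\<^sup>2)"
    by (simp only: complex_norm_square[symmetric] power_mult_distrib of_real_mult)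
  finally have "complex_of_real ((norm (cscale c x))\<^sup>2) = complex_of_real ((cmod c * norm x)\<^sup>2)" .
  then have "(norm (cscale c x))\<^sup>2 = (cmod c * norm x)\<^sup>2"
    by (simp only: of_real_eq_iff)
  then show ?thesis
    by simp
qed

text \<open>Cauchy-Schwarz is read off from the triangle inequality, which every Banach norm
  satisfies, by expanding the square of \<open>norm (x + y)\<close>.\<close>

lemma Re_cinner_le: "Re (cinner (x :: 'a::complex_hilbert) y) \<le> norm x * norm y"
proof -
  have sq: "(norm v)\<^sup>2 = Re (cinner v v)" for v :: 'a
    by (simp add: cinner_self)
  have "(norm (x + y))\<^sup>2 \<le> (norm x + norm y)\<^sup>2"
    by (simp add: norm_triangle_ineq power_mono)
  moreover have "(norm (x + y))\<^sup>2 = (norm x)\<^sup>2 + (norm y)\<^sup>2 + 2 * Re (cinner x y)"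
    using Re_cinner_commute[of x y] unfolding sq by (simp add: cinner_add_left cinner_add_right)
  ultimately show ?thesis
    by (simp add: power2_sum)
qed


section \<open>C*-seminorms from operators on a subspace\<close>

fun letter_gen :: "'x letter \<Rightarrow> 'x" where
  "letter_gen (Gen x) = x"
| "letter_gen (Gen_adj x) = x"

lemma letter_gen_adj [simp]: "letter_gen (letter_adj l) = letter_gen l"
  by (cases l) auto

text \<open>Cancellation can make the support of \<open>f + g\<close> smaller than the union of the
  two supports, so all three sums are first extended by zeros to that union.\<close>

lemma sum_poly_mapping_add:
  fixes h :: "'k \<Rightarrow> 'c::monoid_add \<Rightarrow> 'b::comm_monoid_add"
  assumes "\<And>k. h k 0 = 0" and "\<And>k a b. h k (a + b) = h k a + h k b"
  shows "(\<Sum>k\<in>Poly_Mapping.keys (f + g). h k (Poly_Mapping.lookup (f + g) k)) =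
    (\<Sum>k\<in>Poly_Mapping.keys f. h k (Poly_Mapping.lookup f k)) +
    (\<Sum>k\<in>Poly_Mapping.keys g. h k (Poly_Mapping.lookup g k))"
proof -
  let ?A = "Poly_Mapping.keys f \<union> Poly_Mapping.keys g"
  have ext: "(\<Sum>k\<in>Poly_Mapping.keys e. h k (Poly_Mapping.lookup e k)) =
      (\<Sum>k\<in>?A. h k (Poly_Mapping.lookup e k))" if "Poly_Mapping.keys e \<subseteq> ?A" for e
    using that by (intro sum.mono_neutral_left) (auto simp: in_keys_iff assms)
  have "Poly_Mapping.keys (f + g) \<subseteq> ?A"
    by (metis Poly_Mapping.keys_add)
  from ext[OF this] ext[of f] ext[of g] show ?thesis
    by (simp add: assms Poly_Mapping.lookup_add sum.distrib)
qed

lemma poly_mapping_single_induct [case_names zero add]: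
  fixes f :: "'k \<Rightarrow>\<^sub>0 'c::comm_monoid_add"
  assumes "P 0" and "\<And>w c f. P f \<Longrightarrow> P (Poly_Mapping.single w c + f)"
  shows "P f"
proof -
  have *: "P (\<Sum>w\<in>A. Poly_Mapping.single w (Poly_Mapping.lookup f w))" if "finite A" for A
    using that by (induction A) (auto intro: assms)
  have "f = (\<Sum>w\<in>Poly_Mapping.keys f. Poly_Mapping.single w (Poly_Mapping.lookup f w))"
    by (rule poly_mapping_eqI) (auto simp: lookup_sum lookup_single when_def in_keys_iff)
  with *[OF finite_keys] show ?thesis
    by metis
qed

lemma nc_adj_add: "nc_adj (f + g) = nc_adj f + nc_adj g"
  unfolding nc_adj_def by (rule sum_poly_mapping_add) (simp_all add: single_add)

lemma nc_adj_zero [simp]: "nc_adj 0 = 0"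
  by (simp add: nc_adj_def)

lemma letter_adj_letter_adj [simp]: "letter_adj (letter_adj l) = l"
  by (cases l) auto

lemma word_adj_word_adj [simp]: "word_adj (word_adj w) = w"
proof -
  have "letter_adj \<circ> letter_adj = (id :: 'a letter \<Rightarrow> _)"
    by auto
  then show ?thesis
    by (simp add: word_adj_def rev_map)
qed

lemma nc_adj_nc_adj [simp]: "nc_adj (nc_adj f) = f"
  by (induction f rule: poly_mapping_single_induct) (simp_all add: nc_adj_add nc_adj_single)

text \<open>The relations will be known only on vectors reached from the state, so operators are
  studied on a linear subspace \<open>K\<close>; linearity and self-adjointness hold on the whole
  space.\<close>

locale selfadjoint_family =
  fixes K :: "'h::complex_hilbert set" and u :: "'i \<Rightarrow> 'h \<Rightarrow> 'h"
  assumes zero_mem: "0 \<in> K"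
    and add_mem: "v \<in> K \<Longrightarrow> w \<in> K \<Longrightarrow> v + w \<in> K"
    and cscale_mem: "v \<in> K \<Longrightarrow> cscale c v \<in> K"
    and op_mem: "v \<in> K \<Longrightarrow> u i v \<in> K"
    and op_add: "u i (v + w) = u i v + u i w"
    and op_cscale: "u i (cscale c v) = cscale c (u i v)"
    and op_selfadj: "cinner (u i v) w = cinner v (u i w)"
    and op_norm_le: "v \<in> K \<Longrightarrow> norm (u i v) \<le> norm v"
begin

definition word_op :: "'i word \<Rightarrow> 'h \<Rightarrow> 'h" where
  "word_op w = foldr (\<lambda>l. u (letter_gen l)) (letters w)"

definition poly_op :: "'i ncpoly \<Rightarrow> 'h \<Rightarrow> 'h" where
  "poly_op f v = (\<Sum>w\<in>Poly_Mapping.keys f. cscale (Poly_Mapping.lookup f w) (word_op w v))"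

lemma word_op_add: "word_op w (x + y) = word_op w x + word_op w y"
proof -
  have "foldr (\<lambda>l. u (letter_gen l)) ls (x + y) =
      foldr (\<lambda>l. u (letter_gen l)) ls x + foldr (\<lambda>l. u (letter_gen l)) ls y" for ls
    by (induction ls) (simp_all add: op_add)
  then show ?thesis
    by (simp add: word_op_def)
qed

lemma word_op_cscale: "word_op w (cscale c x) = cscale c (word_op w x)"
proof -
  have "foldr (\<lambda>l. u (letter_gen l)) ls (cscale c x) =
      cscale c (foldr (\<lambda>l. u (letter_gen l)) ls x)" for ls
    by (induction ls) (simp_all add: op_cscale)
  then show ?thesis
    by (simp add: word_op_def)
qed

lemma word_op_mem_norm_le:
  assumes "v \<in> K"
  shows "word_op w v \<in> K \<and> norm (word_op w v) \<le> norm v"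
proof -
  have "foldr (\<lambda>l. u (letter_gen l)) ls v \<in> K \<and>
      norm (foldr (\<lambda>l. u (letter_gen l)) ls v) \<le> norm v" for ls
    by (induction ls) (use assms op_norm_le in \<open>auto intro: op_mem order_trans\<close>)
  then show ?thesis
    by (simp add: word_op_def)
qed

lemma word_op_adj: "cinner (word_op w x) y = cinner x (word_op (word_adj w) y)"
proof -
  have "cinner (foldr (\<lambda>l. u (letter_gen l)) ls x) y =
      cinner x (foldr (\<lambda>l. u (letter_gen l)) (map letter_adj (rev ls)) y)" for ls
    by (induction ls arbitrary: y) (simp_all add: op_selfadj)
  then show ?thesis
    by (simp add: word_op_def word_adj_def)
qed

lemma poly_op_poly_add: "poly_op (f + g) v = poly_op f v + poly_op g v"
  unfolding poly_op_def by (rule sum_poly_mapping_add) (simp_all add: cscale_add_left)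

lemma poly_op_zero [simp]: "poly_op 0 v = 0"
  by (simp add: poly_op_def)

lemma poly_op_single: "poly_op (Poly_Mapping.single w c) v = cscale c (word_op w v)"
  by (simp add: poly_op_def)

lemma poly_op_uminus: "poly_op (- f) v = - poly_op f v"
  using poly_op_poly_add[of f "- f" v] by (simp add: eq_neg_iff_add_eq_0 add.commute)

lemma poly_op_diff: "poly_op (f - g) v = poly_op f v - poly_op g v"
  using poly_op_poly_add[of f "- g" v] by (simp add: poly_op_uminus)

lemma poly_op_sum: "poly_op (sum f A) v = (\<Sum>a\<in>A. poly_op (f a) v)"
  by (induction A rule: infinite_finite_induct) (simp_all add: poly_op_poly_add)

lemma poly_op_one [simp]: "poly_op 1 v = v"
proof -
  have "poly_op (Poly_Mapping.single 0 1) v = v"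
    unfolding poly_op_single by (simp add: word_op_def zero_word_def)
  then show ?thesis by simp
qed

lemma poly_op_gen [simp]: "poly_op (nc_gen x) v = u x v"
  by (simp add: nc_gen_def poly_op_single word_op_def)

lemma poly_op_adj_gen [simp]: "poly_op (nc_adj (nc_gen x)) v = u x v"
  by (simp add: nc_gen_def nc_adj_single poly_op_single word_op_def word_adj_def)

lemma poly_op_cscale: "poly_op f (cscale c x) = cscale c (poly_op f x)"
  by (induction f rule: poly_mapping_single_induct)
    (simp_all add: poly_op_poly_add poly_op_single word_op_cscale cscale_add_right cscale_cscale
      mult.commute)

lemma poly_op_mem: "v \<in> K \<Longrightarrow> poly_op f v \<in> K"
  by (induction f rule: poly_mapping_single_induct)
    (simp_all add: poly_op_poly_add poly_op_single zero_mem add_mem cscale_mem word_op_mem_norm_le)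

lemma poly_op_mult: "poly_op (f * g) v = poly_op f (poly_op g v)"
proof (induction f rule: poly_mapping_single_induct)
  case (add w c f)
  have "poly_op (Poly_Mapping.single w c * g) v = cscale c (word_op w (poly_op g v))"
  proof (induction g rule: poly_mapping_single_induct)
    case zero
    have "word_op w 0 = 0"
      using word_op_add[of w 0 0] by simp
    then show ?case by simp
  next
    case (add w' d g)
    have "word_op (w + w') v = word_op w (word_op w' v)"
      by (simp add: word_op_def plus_word_def)
    with add show ?case
      by (simp add: distrib_left mult_single poly_op_poly_add poly_op_single word_op_add
          word_op_cscale cscale_add_right cscale_cscale)
  qed
  with add show ?case
    by (simp add: distrib_right poly_op_poly_add poly_op_single)
qed simp

lemma poly_op_scale: "poly_op (nc_scale c f) v = cscale c (poly_op f v)"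
  by (simp add: nc_scale_def poly_op_mult poly_op_single word_op_def zero_word_def)

lemma poly_op_adj: "cinner (poly_op f x) y = cinner x (poly_op (nc_adj f) y)"
  by (induction f rule: poly_mapping_single_induct)
    (simp_all add: nc_adj_add nc_adj_single poly_op_poly_add poly_op_single cinner_add_left
      cinner_add_right cinner_cscale_left cinner_cscale_right word_op_adj)

section \<open>The operator norm on \<open>K\<close> as a C*-seminorm\<close>

definition op_seminorm :: "'i ncpoly \<Rightarrow> real" where
  "op_seminorm f = (SUP v\<in>{v\<in>K. norm v \<le> 1}. norm (poly_op f v))"

text \<open>Words act as contractions on \<open>K\<close>. The resulting bound keeps the supremum in
  \<open>op_seminorm\<close> finite.\<close>

lemma poly_op_bound:
  "v \<in> K \<Longrightarrow> norm (poly_op f v) \<le>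
    (\<Sum>w\<in>Poly_Mapping.keys f. cmod (Poly_Mapping.lookup f w)) * norm v"
  unfolding poly_op_def sum_distrib_right
  by (rule order_trans[OF norm_sum sum_mono]) (simp add: mult_left_mono word_op_mem_norm_le)

lemma norm_poly_op_le_seminorm:
  assumes "v \<in> K" and "norm v \<le> 1"
  shows "norm (poly_op f v) \<le> op_seminorm f"
proof -
  let ?C = "\<Sum>w\<in>Poly_Mapping.keys f. cmod (Poly_Mapping.lookup f w)"
  have "norm (poly_op f v) \<le> ?C" if "v \<in> K" "norm v \<le> 1" for v
    using poly_op_bound[OF that(1), of f] that(2)
    by (meson mult_left_le order_trans sum_nonneg norm_ge_zero)
  then have "bdd_above ((\<lambda>v. norm (poly_op f v)) ` {v\<in>K. norm v \<le> 1})"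
    by (intro bdd_aboveI2[where M = ?C]) auto
  then show ?thesis
    unfolding op_seminorm_def by (rule cSUP_upper2) (use assms in auto)
qed

lemma op_seminorm_least:
  assumes "\<And>v. v \<in> K \<Longrightarrow> norm v \<le> 1 \<Longrightarrow> norm (poly_op f v) \<le> b"
  shows "op_seminorm f \<le> b"
  unfolding op_seminorm_def by (rule cSUP_least) (use assms zero_mem in auto)

lemma op_seminorm_nonneg: "0 \<le> op_seminorm f"
  using norm_poly_op_le_seminorm[OF zero_mem, of f] by (simp add: order_trans[OF norm_ge_zero])

lemma norm_poly_op_le:
  assumes "v \<in> K"
  shows "norm (poly_op f v) \<le> op_seminorm f * norm v"
proof (cases "v = 0")
  case True
  then show ?thesis
    using poly_op_bound[OF zero_mem, of f] by simp
next
  case False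
  let ?w = "cscale (complex_of_real (inverse (norm v))) v"
  have "norm (poly_op f ?w) \<le> op_seminorm f"
    using False assms by (intro norm_poly_op_le_seminorm cscale_mem) (auto simp: norm_inverse)
  then show ?thesis
    using False by (simp add: poly_op_cscale norm_inverse) (simp add: field_simps)
qed

lemma op_seminorm_mult: "op_seminorm (f * g) \<le> op_seminorm f * op_seminorm g"
proof (rule op_seminorm_least)
  fix v assume v: "v \<in> K" "norm v \<le> 1"
  have "norm (poly_op f (poly_op g v)) \<le> op_seminorm f * norm (poly_op g v)"
    using v by (intro norm_poly_op_le poly_op_mem)
  also have "\<dots> \<le> op_seminorm f * op_seminorm g"
    using v by (intro mult_left_mono norm_poly_op_le_seminorm op_seminorm_nonneg)
  finally show "norm (poly_op (f * g) v) \<le> op_seminorm f * op_seminorm g"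
    by (simp add: poly_op_mult)
qed

text \<open>The squared norm of \<open>poly_op f v\<close> equals the inner product of
  \<open>v\<close> with \<open>poly_op (nc_adj f * f) v\<close>; then Cauchy-Schwarz
  applies.\<close>

lemma op_seminorm_sq_le: "(op_seminorm f)\<^sup>2 \<le> op_seminorm (nc_adj f * f)"
proof -
  have "norm (poly_op f v) \<le> sqrt (op_seminorm (nc_adj f * f))" if v: "v \<in> K" "norm v \<le> 1" for v
  proof -
    have "(norm (poly_op f v))\<^sup>2 = Re (cinner v (poly_op (nc_adj f * f) v))"
      by (simp add: poly_op_mult flip: poly_op_adj) (simp add: cinner_self)
    also have "\<dots> \<le> norm v * norm (poly_op (nc_adj f * f) v)"
      by (rule Re_cinner_le)
    also have "\<dots> \<le> 1 * op_seminorm (nc_adj f * f)"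
      using v by (intro mult_mono norm_poly_op_le_seminorm) auto
    finally show ?thesis
      by (simp add: real_le_rsqrt)
  qed
  then have "op_seminorm f \<le> sqrt (op_seminorm (nc_adj f * f))"
    by (rule op_seminorm_least)
  then show ?thesis
    using op_seminorm_nonneg power_mono[of "op_seminorm f" _ 2] by fastforce
qed

text \<open>Apply \<open>op_seminorm_sq_le\<close> to \<open>nc_adj f\<close>, use
  submultiplicativity, and cancel one factor.\<close>

lemma op_seminorm_adj_le: "op_seminorm (nc_adj f) \<le> op_seminorm f"
proof -
  have "(op_seminorm (nc_adj f))\<^sup>2 \<le> op_seminorm f * op_seminorm (nc_adj f)"
    using op_seminorm_sq_le[of "nc_adj f"] op_seminorm_mult[of f "nc_adj f"] by simp
  then show ?thesis
    using op_seminorm_nonneg[of f] op_seminorm_nonneg[of "nc_adj f"]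
    by (cases "op_seminorm (nc_adj f) = 0") (auto simp: power2_eq_square)
qed

theorem cstar_seminorm_op_seminorm: "cstar_seminorm op_seminorm"
  unfolding cstar_seminorm_def
proof (intro conjI allI)
  fix f g :: "'i ncpoly" and c :: complex
  show "0 \<le> op_seminorm f"
    by (rule op_seminorm_nonneg)
  show "op_seminorm (f + g) \<le> op_seminorm f + op_seminorm g"
    by (rule op_seminorm_least)
      (auto simp: poly_op_poly_add intro!: norm_triangle_le add_mono norm_poly_op_le_seminorm)
  show "op_seminorm (f * g) \<le> op_seminorm f * op_seminorm g"
    by (rule op_seminorm_mult)
  have scale_le: "op_seminorm (nc_scale c f) \<le> cmod c * op_seminorm f" for c f
    by (rule op_seminorm_least) (simp add: poly_op_scale mult_left_mono norm_poly_op_le_seminorm)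
  show "op_seminorm (nc_scale c f) = cmod c * op_seminorm f"
  proof (cases "c = 0")
    case True
    then show ?thesis
      using scale_le[of c f] op_seminorm_nonneg[of "nc_scale c f"] by simp
  next
    case False
    \<comment> \<open>The reverse inequality is \<open>scale_le\<close> used for the inverse
      scalar.\<close>
    have "nc_scale (inverse c) (nc_scale c f) = f"
      using False by (simp add: nc_scale_def mult_single flip: mult.assoc)
    then have "op_seminorm f \<le> cmod (inverse c) * op_seminorm (nc_scale c f)"
      using scale_le by metis
    then show ?thesis
      using False scale_le[of c f] by (simp add: norm_divide field_simps)
  qed
  have "op_seminorm (nc_adj f * f) \<le> op_seminorm (nc_adj f) * op_seminorm f"
    by (rule op_seminorm_mult)
  also have "\<dots> \<le> op_seminorm f * op_seminorm f"
    by (intro mult_right_mono op_seminorm_adj_le op_seminorm_nonneg)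
  finally show "op_seminorm (nc_adj f * f) = (op_seminorm f)\<^sup>2"
    using op_seminorm_sq_le[of f] by (simp add: power2_eq_square)
qed

lemma op_seminorm_eq_0_iff: "op_seminorm f = 0 \<longleftrightarrow> (\<forall>v\<in>K. poly_op f v = 0)"
proof
  assume "op_seminorm f = 0"
  then show "\<forall>v\<in>K. poly_op f v = 0"
    using norm_poly_op_le[of _ f] by simp
next
  assume "\<forall>v\<in>K. poly_op f v = 0"
  then have "op_seminorm f \<le> 0"
    by (intro op_seminorm_least) simp
  then show "op_seminorm f = 0"
    using op_seminorm_nonneg[of f] by simp
qed

end

section \<open>Representations of the quantum automorphism group\<close>

lemma cstar_seminorm_minus:
  assumes "cstar_seminorm p"
  shows "p (- f) = p f"
proof -
  have "nc_scale (- 1) f = - f"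
    by (simp add: nc_scale_def single_uminus)
  with assms show ?thesis
    unfolding cstar_seminorm_def by (metis mult_1 norm_minus_cancel norm_one)
qed

lemma cstar_seminorm_zero:
  assumes "cstar_seminorm p"
  shows "p 0 = 0"
proof -
  have "p (nc_scale 0 0) = cmod 0 * p 0"
    using assms unfolding cstar_seminorm_def by blast
  then show ?thesis
    by (simp add: nc_scale_def)
qed

text \<open>Constant sequences embed polynomials in the completion, where they commute by
  assumption. As \<open>p\<close> is dominated by the universal seminorm, null sequences there are
  null for \<open>p\<close>.\<close>

lemma seminorm_commutator_eq_0:
  assumes "no_quantum_symmetry E" and p: "p \<in> admissible_seminorms (qut_relators E)"
  shows "p (g * f - f * g) = 0"
proof -
  define R where "R = qut_relators E"
  define U where "U = universal_seminorm R"
  have cs: "cstar_seminorm p"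
    using p by (simp add: admissible_seminorms_def)
  then have nn: "0 \<le> p a" and tri: "p (a + b) \<le> p a + p b" and sub: "p (a * b) \<le> p a * p b"
    for a b
    by (auto simp: cstar_seminorm_def)
  note minus = cstar_seminorm_minus[OF cs]
  have le: "p a \<le> U a" for a
    unfolding U_def R_def universal_seminorm_def
    using p by (intro cSUP_upper bdd_above_qut_seminorms)
  \<comment> \<open>Constant sequences are Cauchy because of this; \<open>p\<close> itself witnesses
    that the supremum is over a nonempty set.\<close>
  have U0: "U 0 = 0"
  proof -
    have "U 0 = (SUP q\<in>admissible_seminorms R. 0)"
      unfolding U_def universal_seminorm_def
      by (intro SUP_cong) (auto simp: admissible_seminorms_def cstar_seminorm_zero)
    also have "\<dots> = 0"
      using p by (subst cSUP_const) (auto simp: R_def)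
    finally show ?thesis .
  qed
  have const: "(\<lambda>n. a) \<in> nc_class R (\<lambda>n. a)" for a
    using U0 by (simp add: nc_class_def nc_null_rel_def nc_Cauchy_def U_def)
  have carrier: "nc_class R (\<lambda>n. a) \<in> carrier (C_Qut E)" for a
    using U0 by (auto simp: C_Qut_def universal_cstar_algebra_def nc_class_def nc_Cauchy_def U_def
        R_def[symmetric] intro!: quotientI)
  let ?X = "nc_class R (\<lambda>n. f)" and ?Y = "nc_class R (\<lambda>n. g)"
  have mult: "x \<otimes>\<^bsub>C_Qut E\<^esub> y = (\<Union>s\<in>x. \<Union>t\<in>y. nc_class R (\<lambda>n. s n * t n))" for x y
    by (simp add: C_Qut_def universal_cstar_algebra_def R_def)
  have "(\<lambda>n. f * g) \<in> ?X \<otimes>\<^bsub>C_Qut E\<^esub> ?Y"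
    unfolding mult using const by blast
  also have "?X \<otimes>\<^bsub>C_Qut E\<^esub> ?Y = ?Y \<otimes>\<^bsub>C_Qut E\<^esub> ?X"
    using assms(1) carrier unfolding no_quantum_symmetry_def by blast
  \<comment> \<open>Multiplication of classes is a union over representatives, so this yields some
    representatives \<open>s\<close> and \<open>t\<close>, not the constant sequences
    themselves.\<close>
  finally obtain s t where s: "s \<in> ?Y" and t: "t \<in> ?X"
    and st: "(\<lambda>n. f * g) \<in> nc_class R (\<lambda>n. s n * t n)"
    unfolding mult by blast
  have lim: "(\<lambda>n. p (a n - b n)) \<longlonglongrightarrow> 0" if "b \<in> nc_class R a" for a b
  proof (rule tendsto_sandwich[of "\<lambda>_. 0"])
    show "(\<lambda>n. U (a n - b n)) \<longlonglongrightarrow> 0"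
      using that by (simp add: nc_class_def nc_null_rel_def U_def)
  qed (use le nn in auto)
  let ?b = "\<lambda>n. p (g - s n) * p f + p g * p (f - t n) + p (g - s n) * p (f - t n)
    + p (s n * t n - f * g)"
  have "?b \<longlonglongrightarrow> 0 * p f + p g * 0 + 0 * 0 + 0"
    by (intro tendsto_add tendsto_mult tendsto_const lim[OF s] lim[OF t] lim[OF st])
  then have "?b \<longlonglongrightarrow> 0"
    by simp
  moreover have "p (g * f - f * g) \<le> ?b n" for n
  proof -
    \<comment> \<open>Expanding to second order around \<open>g\<close> and \<open>f\<close> leaves
      only terms that tend to zero, so no bounds on \<open>s n\<close> and \<open>t n\<close>
      themselves enter.\<close>
    have "g * f - f * g = (g - s n) * f + g * (f - t n) + - ((g - s n) * (f - t n))
        + (s n * t n - f * g)"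
      by (simp add: algebra_simps)
    moreover have "p (a + b + - c + d) \<le> p a + p b + p c + p d" for a b c d
      using tri[of "a + b + - c" d] tri[of "a + b" "- c"] tri[of a b] unfolding minus by linarith
    ultimately have "p (g * f - f * g) \<le> p ((g - s n) * f) + p (g * (f - t n))
        + p ((g - s n) * (f - t n)) + p (s n * t n - f * g)"
      by metis
    also have "\<dots> \<le> ?b n"
      by (intro add_mono sub order_refl)
    finally show ?thesis .
  qed
  ultimately have "p (g * f - f * g) \<le> 0"
    by (intro LIMSEQ_le_const[of ?b]) auto
  with nn show ?thesis
    by (simp add: antisym)
qed

text \<open>\<open>op_orth\<close> stands in for \<open>U A = A U\<close>, because orthogonality is
  what a winning strategy supplies; \<open>commutes_adj_matrix\<close> recovers the matrix
  relation.\<close>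

locale qut_representation =
  fixes E :: "'v::finite \<Rightarrow> 'v \<Rightarrow> bool"
    and K :: "'h::complex_hilbert set" and u :: "'v \<Rightarrow> 'v \<Rightarrow> 'h \<Rightarrow> 'h"
  assumes zero_mem: "0 \<in> K"
    and add_mem: "v \<in> K \<Longrightarrow> w \<in> K \<Longrightarrow> v + w \<in> K"
    and cscale_mem: "v \<in> K \<Longrightarrow> cscale c v \<in> K"
    and op_mem [simp]: "v \<in> K \<Longrightarrow> u i j v \<in> K"
    and op_add: "u i j (v + w) = u i j v + u i j w"
    and op_cscale: "u i j (cscale c v) = cscale c (u i j v)"
    and op_selfadj: "cinner (u i j v) w = cinner v (u i j w)"
    and op_idem: "v \<in> K \<Longrightarrow> u i j (u i j v) = u i j v"
    and row_sum: "v \<in> K \<Longrightarrow> (\<Sum>j\<in>UNIV. u i j v) = v"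
    and col_sum: "v \<in> K \<Longrightarrow> (\<Sum>i\<in>UNIV. u i j v) = v"
    and op_orth: "v \<in> K \<Longrightarrow> vrel E i j \<noteq> vrel E l k \<Longrightarrow> u i l (u j k v) = 0"
begin

lemma op_zero [simp]: "u i j 0 = 0"
  using op_add[of i j 0 0] by simp

lemma op_sum: "u i j (sum f A) = (\<Sum>a\<in>A. u i j (f a))"
  by (induction A rule: infinite_finite_induct) (simp_all add: op_add)

lemma sum_mem: "(\<And>a. a \<in> A \<Longrightarrow> f a \<in> K) \<Longrightarrow> sum f A \<in> K"
  by (induction A rule: infinite_finite_induct) (simp_all add: zero_mem add_mem)

lemma op_norm_le:
  assumes "v \<in> K"
  shows "norm (u i j v) \<le> norm v"
proof -
  have "(norm (u i j v))\<^sup>2 = Re (cinner (u i j v) (u i j v))"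
    by (simp add: cinner_self)
  also have "\<dots> = Re (cinner v (u i j v))"
    using assms by (simp add: op_selfadj op_idem)
  also have "\<dots> \<le> norm v * norm (u i j v)"
    by (rule Re_cinner_le)
  finally show ?thesis
    by (cases "u i j v = 0") (simp_all add: power2_eq_square)
qed

text \<open>Insert the column sum over \<open>l\<close> into the left side. By orthogonality only
  terms with \<open>E k j = E i l\<close> survive, so the condition can be switched, and the row sum
  over \<open>k\<close> then collapses.\<close>

lemma commutes_adj_matrix:
  assumes "irreflp E" and "v \<in> K"
  shows "(\<Sum>k\<in>UNIV. if E k j then u i k v else 0) = (\<Sum>k\<in>UNIV. if E i k then u k j v else 0)"
proof -
  have "(\<Sum>k\<in>UNIV. if E k j then u i k v else 0) =
      (\<Sum>k\<in>UNIV. if E k j then u i k (\<Sum>l\<in>UNIV. u l j v) else 0)"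
    by (simp only: col_sum[OF assms(2)])
  also have "\<dots> = (\<Sum>k\<in>UNIV. \<Sum>l\<in>UNIV. if E k j then u i k (u l j v) else 0)"
    by (intro sum.cong) (auto simp: op_sum)
  also have "\<dots> = (\<Sum>k\<in>UNIV. \<Sum>l\<in>UNIV. if E i l then u i k (u l j v) else 0)"
  proof (intro sum.cong refl)
    fix k l
    have "u i k (u l j v) = 0" if "E k j \<noteq> E i l"
      using that assms by (intro op_orth) (auto simp: vrel_def irreflp_def)
    then show "(if E k j then u i k (u l j v) else 0) = (if E i l then u i k (u l j v) else 0)"
      by auto
  qed
  also have "\<dots> = (\<Sum>l\<in>UNIV. if E i l then (\<Sum>k\<in>UNIV. u i k (u l j v)) else 0)"
    by (subst sum.swap) (auto intro!: sum.cong)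
  also have "\<dots> = (\<Sum>k\<in>UNIV. if E i k then u k j v else 0)"
    by (simp only: row_sum[OF op_mem[OF assms(2)]])
  finally show ?thesis .
qed

text \<open>The operators annihilate all relators on \<open>K\<close>, so their operator seminorm is
  admissible and vanishes on commutators.\<close>

theorem no_quantum_symmetry_commute:
  assumes "irreflp E" and "no_quantum_symmetry E" and "v \<in> K"
  shows "u i j (u k l v) = u k l (u i j v)"
proof -
  interpret fam: selfadjoint_family K "\<lambda>(i, j). u i j"
    by unfold_locales
      (auto simp: zero_mem add_mem cscale_mem op_add op_cscale op_selfadj op_norm_le)
  have adj: "fam.poly_op (adj_matrix E a b) w = (if E a b then w else 0)" for a b w
    by (simp add: adj_matrix_def)
  have "fam.poly_op r w = 0" if "r \<in> qut_relators E" "w \<in> K" for r w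
  proof -
    have "(\<Sum>k\<in>UNIV. u i k (if E k j then w else 0)) =
        (\<Sum>k\<in>UNIV. if E k j then u i k w else 0)" for i j
      by (intro sum.cong) auto
    with that assms(1) show ?thesis
      unfolding qut_relators_def
      by (auto simp: fam.poly_op_diff fam.poly_op_sum fam.poly_op_mult adj op_idem row_sum col_sum
          commutes_adj_matrix)
  qed
  then have "fam.op_seminorm \<in> admissible_seminorms (qut_relators E)"
    by (simp add: admissible_seminorms_def fam.cstar_seminorm_op_seminorm fam.op_seminorm_eq_0_iff)
  then have "fam.op_seminorm (qut_gen i j * qut_gen k l - qut_gen k l * qut_gen i j) = 0"
    by (rule seminorm_commutator_eq_0[OF assms(2)])
  then show ?thesis
    using assms(3) by (simp add: fam.op_seminorm_eq_0_iff fam.poly_op_diff fam.poly_op_mult)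
qed

end

section \<open>Two copies of a connected graph\<close>

text \<open>The boolean index treats both copies at once, with negation giving the other
  copy.\<close>

fun copy :: "bool \<Rightarrow> 'v \<Rightarrow> 'v + 'v" where
  "copy False x = Inl x"
| "copy True x = Inr x"

lemma copy_eq_iff [simp]: "copy a x = copy b y \<longleftrightarrow> a = b \<and> x = y"
  by (cases a; cases b) auto

lemma two_copies_copy [simp]: "two_copies G (copy a x) (copy b y) \<longleftrightarrow> a = b \<and> G x y"
  by (cases a; cases b) (auto simp: two_copies_def)

lemma vrel_two_copies:
  "vrel (two_copies G) (copy a x) (copy b y) = (if a = b then vrel G x y else Nonadjacent)"
  by (auto simp: vrel_def)

lemma sum_two_copies:
  fixes f :: "'v::finite + 'v \<Rightarrow> 'b::comm_monoid_add"
  shows "(\<Sum>z\<in>UNIV. f z) = (\<Sum>y\<in>UNIV. f (copy b y)) + (\<Sum>y\<in>UNIV. f (copy (\<not> b) y))"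
proof -
  have "(\<Sum>z\<in>UNIV. f z) = (\<Sum>y\<in>UNIV. f (Inl y)) + (\<Sum>y\<in>UNIV. f (Inr y))"
    unfolding UNIV_Plus_UNIV[symmetric] by (subst sum.Plus) (auto simp: o_def)
  then show ?thesis
    by (cases b) (simp_all add: add.commute)
qed

locale two_copies_representation = qut_representation "two_copies G" K u
  for G :: "'v::finite \<Rightarrow> 'v \<Rightarrow> bool"
    and K :: "'h::complex_hilbert set" and u :: "'v + 'v \<Rightarrow> 'v + 'v \<Rightarrow> 'h \<Rightarrow> 'h" +
  assumes simple: "simple_graph G" and connected: "connected_graph G"
begin

section \<open>Projections recording which copy is mapped to which\<close>

definition row_block :: "bool \<Rightarrow> bool \<Rightarrow> 'v \<Rightarrow> 'h \<Rightarrow> 'h" where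
  "row_block a b x v = (\<Sum>y\<in>UNIV. u (copy a x) (copy b y) v)"

text \<open>Where \<open>row_block\<close> asks into which copy a given vertex is sent, this asks
  from which copy a given vertex is reached.\<close>

definition col_block :: "bool \<Rightarrow> bool \<Rightarrow> 'v \<Rightarrow> 'h \<Rightarrow> 'h" where
  "col_block a b y v = (\<Sum>x\<in>UNIV. u (copy a x) (copy b y) v)"

lemma row_block_mem [simp]: "v \<in> K \<Longrightarrow> row_block a b x v \<in> K"
  unfolding row_block_def by (intro sum_mem) simp

lemma col_block_mem [simp]: "v \<in> K \<Longrightarrow> col_block a b y v \<in> K"
  unfolding col_block_def by (intro sum_mem) simp

lemma row_block_add: "row_block a b x (v + w) = row_block a b x v + row_block a b x w"
  by (simp add: row_block_def op_add sum.distrib)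

lemma col_block_add: "col_block a b y (v + w) = col_block a b y v + col_block a b y w"
  by (simp add: col_block_def op_add sum.distrib)

lemma row_block_sum: "row_block a b x (sum f A) = (\<Sum>i\<in>A. row_block a b x (f i))"
  unfolding row_block_def op_sum by (rule sum.swap)

lemma row_block_complement: "v \<in> K \<Longrightarrow> row_block a b x v + row_block a (\<not> b) x v = v"
  using row_sum[of v "copy a x"] by (simp add: row_block_def sum_two_copies[of _ b])

lemma col_block_complement: "v \<in> K \<Longrightarrow> col_block a b y v + col_block (\<not> a) b y v = v"
  using col_sum[of v "copy b y"] by (simp add: col_block_def sum_two_copies[of _ a])

lemma vrel_edge: "G x y \<Longrightarrow> vrel G x y = Adjacent"
  using simple by (auto simp: vrel_def simple_graph_def irreflp_def)

lemma connected_induct: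
  assumes "\<And>x y. G x y \<Longrightarrow> f x = f y"
  shows "f x = f y"
proof -
  have "G\<^sup>*\<^sup>* x y"
    using connected by (simp add: connected_graph_def)
  then show ?thesis
    by induction (use assms in auto)
qed

text \<open>
  Adjacent vertices of one copy cannot be sent to different copies, so the projection for
  the event that the image of the vertex lies in copy \<open>b\<close> is constant along edges.
\<close>

lemma row_block_const:
  assumes v: "v \<in> K"
  shows "row_block a b x v = row_block a b y v"
proof (rule connected_induct)
  fix x y assume "G x y"
  then have orth: "row_block a b x (row_block a (\<not> b) y w) = 0" if "w \<in> K" for b w
    using that unfolding row_block_def op_sum
    by (intro sum.neutral ballI op_orth) (auto simp: vrel_two_copies vrel_edge)
  have "row_block a b x v = row_block a b x (row_block a b y v + row_block a (\<not> b) y v)"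
    using v by (simp only: row_block_complement)
  also have "\<dots> = row_block a b x (row_block a b y v)"
    using orth[OF v] by (simp add: row_block_add)
  \<comment> \<open>Adding the vanishing cross term completes the two blocks at \<open>x\<close> to
    the identity.\<close>
  also have "\<dots> = row_block a b x (row_block a b y v) + row_block a (\<not> b) x (row_block a b y v)"
    using orth[OF v, of "\<not> b"] by simp
  also have "\<dots> = row_block a b y v"
    using v by (simp add: row_block_complement)
  finally show "row_block a b x v = row_block a b y v" .
qed

text \<open>The transposed argument: adjacent answers cannot come from questions in different
  copies.\<close>

lemma col_block_const:
  assumes v: "v \<in> K"
  shows "col_block a b x v = col_block a b y v"
proof (rule connected_induct)
  fix x y assume "G x y"
  then have orth: "col_block a b x (col_block (\<not> a) b y w) = 0" if "w \<in> K" for a w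
    using that unfolding col_block_def op_sum
    by (intro sum.neutral ballI op_orth) (auto simp: vrel_two_copies vrel_edge)
  have "col_block a b x v = col_block a b x (col_block a b y v + col_block (\<not> a) b y v)"
    using v by (simp only: col_block_complement)
  also have "\<dots> = col_block a b x (col_block a b y v)"
    using orth[OF v] by (simp add: col_block_add)
  also have "\<dots> = col_block a b x (col_block a b y v) + col_block (\<not> a) b x (col_block a b y v)"
    using orth[OF v, of "\<not> a"] by simp
  also have "\<dots> = col_block a b y v"
    using v by (simp add: col_block_complement)
  finally show "col_block a b x v = col_block a b y v" .
qed

lemma op_row_orth: "v \<in> K \<Longrightarrow> l \<noteq> k \<Longrightarrow> u i l (u i k v) = 0"
  by (rule op_orth) (auto simp: vrel_def)

lemma op_col_orth: "v \<in> K \<Longrightarrow> i \<noteq> j \<Longrightarrow> u i l (u j l v) = 0"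
  by (rule op_orth) (auto simp: vrel_def)

text \<open>Constancy moves the block from \<open>z\<close> to \<open>x\<close>, where orthogonality
  within one row decides every term.\<close>

lemma row_block_op:
  assumes "v \<in> K"
  shows "row_block a b z (u (copy a x) (copy c y) v) = (if b = c then u (copy a x) (copy c y) v else 0)"
proof -
  have "row_block a b z (u (copy a x) (copy c y) v) = row_block a b x (u (copy a x) (copy c y) v)"
    using assms by (intro row_block_const) simp
  also have "\<dots> = (\<Sum>y'\<in>UNIV. if y' = y then if b = c then u (copy a x) (copy c y) v else 0 else 0)"
    unfolding row_block_def using assms by (intro sum.cong) (auto simp: op_idem op_row_orth)
  finally show ?thesis
    by simp
qed

lemma op_col_block:
  assumes "v \<in> K"
  shows "u (copy a x) (copy b y) (col_block a b z v) = u (copy a x) (copy b y) v"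
proof -
  have "u (copy a x) (copy b y) (col_block a b z v) = u (copy a x) (copy b y) (col_block a b y v)"
    using assms by (simp only: col_block_const[of v a b z y])
  also have "\<dots> = (\<Sum>x'\<in>UNIV. if x' = x then u (copy a x) (copy b y) v else 0)"
    unfolding col_block_def op_sum using assms by (intro sum.cong) (auto simp: op_idem op_col_orth)
  finally show ?thesis
    by simp
qed

text \<open>The product of the two blocks equals either one: the row block absorbs the column block
  on its right, and the column block absorbs the row block on its left.\<close>

lemma row_block_eq_col_block:
  assumes v: "v \<in> K"
  shows "row_block a b x v = col_block a b y v"
proof -
  have "row_block a b x v = row_block a b x (col_block a b y v)"
    using v by (simp add: row_block_def op_col_block)
  also have "\<dots> = col_block a b y v"
    using v by (simp add: col_block_def row_block_sum row_block_op)
  finally show ?thesis .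
qed

text \<open>The inner operator lies in the range of the row block for \<open>c\<close>, and that
  block can be taken in row \<open>x\<close>, where it is orthogonal to answers in copy
  \<open>b\<close>.\<close>

lemma op_block_orth:
  assumes v: "v \<in> K" and "b \<noteq> c"
  shows "u (copy a x) (copy b y) (u (copy a x') (copy c y') v) = 0"
proof -
  let ?w = "u (copy a x') (copy c y') v"
  have "?w = row_block a c x ?w"
    using v by (simp add: row_block_op)
  then have "u (copy a x) (copy b y) ?w = u (copy a x) (copy b y) (row_block a c x ?w)"
    by simp
  also have "\<dots> = 0"
    unfolding row_block_def op_sum using assms by (intro sum.neutral ballI op_row_orth) auto
  finally show ?thesis .
qed

section \<open>Forgetting the copy of the answer\<close>

definition fold_op :: "bool \<Rightarrow> 'v \<Rightarrow> 'v \<Rightarrow> 'h \<Rightarrow> 'h" where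
  "fold_op a x y v = u (copy a x) (copy False y) v + u (copy a x) (copy True y) v"

lemma qut_representation_fold_op: "qut_representation G K (fold_op a)"
proof
  fix x y :: 'v and v assume v: "v \<in> K"
  show "fold_op a x y (fold_op a x y v) = fold_op a x y v"
    using v by (simp add: fold_op_def op_add op_idem op_row_orth)
  show "(\<Sum>y\<in>UNIV. fold_op a x y v) = v"
    using v row_block_complement[of v a False x]
    by (simp add: fold_op_def sum.distrib row_block_def)
  have "(\<Sum>x\<in>UNIV. fold_op a x y v) = col_block a False y v + col_block a True y v"
    by (simp add: fold_op_def sum.distrib col_block_def)
  \<comment> \<open>The column relation of \<open>u\<close> sums over source copies with the target
    fixed, whereas here the source is fixed and the target varies. Trading column blocks for row
    blocks reduces this to a row relation.\<close>
  also have "\<dots> = row_block a False x v + row_block a True x v"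
    by (simp only: row_block_eq_col_block[OF v, of _ _ x y])
  also have "\<dots> = v"
    using v row_block_complement[of v a False x] by simp
  finally show "(\<Sum>x\<in>UNIV. fold_op a x y v) = v" .
next
  fix v and i j l k :: 'v assume v: "v \<in> K" and "vrel G i j \<noteq> vrel G l k"
  then have "u (copy a i) (copy b l) (u (copy a j) (copy b k) v) = 0" for b
    by (intro op_orth) (auto simp: vrel_two_copies)
  from this[of False] this[of True] v show "fold_op a i l (fold_op a j k v) = 0"
    by (simp add: fold_op_def op_add op_block_orth[of _ False True] op_block_orth[of _ True False]
        del: copy.simps)
qed (auto simp: fold_op_def zero_mem add_mem cscale_mem op_add op_cscale cscale_add_right
    cinner_add_left cinner_add_right op_selfadj)

theorem op_commute_within_copy:
  assumes "no_quantum_symmetry G" and v: "v \<in> K"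
  shows "u (copy a x) l (u (copy a x') l' v) = u (copy a x') l' (u (copy a x) l v)"
proof -
  have "\<exists>b y. z = copy b y" for z :: "'v + 'v"
    by (metis copy.simps sum.exhaust)
  then obtain b y b' y' where l: "l = copy b y" "l' = copy b' y'"
    by metis
  show ?thesis
  proof (cases "b = b'")
    case False
    then show ?thesis
      using v by (auto simp: l op_block_orth)
  next
    case True
    have cross: "u (copy a x) (copy False y) (u (copy a x') (copy True y') v) = 0"
      "u (copy a x) (copy True y) (u (copy a x') (copy False y') v) = 0" for x y x' y'
      using v by (auto intro: op_block_orth simp del: copy.simps)
    \<comment> \<open>The row block cuts the component with answers in copy \<open>b\<close> out of
      a product of folded operators; mixed products have already vanished.\<close>
    have block: "row_block a b x (fold_op a x\<^sub>1 y\<^sub>1 (fold_op a x\<^sub>2 y\<^sub>2 v)) =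
        u (copy a x\<^sub>1) (copy b y\<^sub>1) (u (copy a x\<^sub>2) (copy b y\<^sub>2) v)" for x\<^sub>1 y\<^sub>1 x\<^sub>2 y\<^sub>2
      using v by (cases b)
        (simp_all add: fold_op_def op_add cross row_block_add row_block_op del: copy.simps)
    have "irreflp G"
      using simple by (simp add: simple_graph_def)
    then have "fold_op a x y (fold_op a x' y' v) = fold_op a x' y' (fold_op a x y v)"
      by (rule qut_representation.no_quantum_symmetry_commute[OF qut_representation_fold_op _ assms])
    then have "row_block a b x (fold_op a x y (fold_op a x' y' v)) =
        row_block a b x (fold_op a x' y' (fold_op a x y v))"
      by simp
    then show ?thesis
      unfolding block by (simp add: l True)
  qed
qed

end

section \<open>Tracial vector states\<close>

context qut_representation
begin

section \<open>Products of generators along lists of vertex pairs\<close>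

definition path_op :: "('v \<times> 'v) list \<Rightarrow> 'h \<Rightarrow> 'h" where
  "path_op = foldr (\<lambda>(i, l). u i l)"

lemma path_op_Nil [simp]: "path_op [] v = v"
  by (simp add: path_op_def)

lemma path_op_Cons [simp]: "path_op ((i, l) # ps) v = u i l (path_op ps v)"
  by (simp add: path_op_def)

lemma path_op_append [simp]: "path_op (ps @ qs) v = path_op ps (path_op qs v)"
  by (simp add: path_op_def)

lemma path_op_mem [simp]: "v \<in> K \<Longrightarrow> path_op ps v \<in> K"
  by (induction ps) auto

lemma path_op_zero [simp]: "path_op ps 0 = 0"
  by (induction ps) auto

text \<open>Distributivity: summing a product over all choice functions gives the product of the
  sums.\<close>

lemma sum_path_op:
  assumes "distinct L"
  shows "(\<Sum>\<sigma>\<in>PiE (set L) A. path_op (map (\<lambda>i. (i, \<sigma> i)) L) v) =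
    foldr (\<lambda>i v. \<Sum>l\<in>A i. u i l v) L v"
  using assms
proof (induction L)
  case (Cons i L)
  let ?path = "\<lambda>\<sigma>. path_op (map (\<lambda>i. (i, \<sigma> i)) L) v"
  have path_upd: "?path (g(i := y)) = ?path g" for g :: "'v \<Rightarrow> 'v" and y
  proof -
    have "map (\<lambda>j. (j, (g(i := y)) j)) L = map (\<lambda>j. (j, g j)) L"
      using Cons.prems by auto
    then show ?thesis
      by (simp only:)
  qed
  have inj: "inj_on (\<lambda>(y, g). g(i := y)) (A i \<times> PiE (set L) A)"
    using Cons.prems by (intro inj_combinator) simp
  have "PiE (set (i # L)) A = (\<lambda>(y, g). g(i := y)) ` (A i \<times> PiE (set L) A)"
    by (simp add: PiE_insert_eq)
  then have "(\<Sum>\<sigma>\<in>PiE (set (i # L)) A. path_op (map (\<lambda>i. (i, \<sigma> i)) (i # L)) v) =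
      (\<Sum>(y, g)\<in>A i \<times> PiE (set L) A. path_op (map (\<lambda>j. (j, (g(i := y)) j)) (i # L)) v)"
    using sum.reindex[OF inj] by (simp add: o_def split_def del: list.map fun_upd_apply)
  also have "\<dots> = (\<Sum>(y, g)\<in>A i \<times> PiE (set L) A. u i y (?path (g(i := y))))"
    by (simp only: list.map path_op_Cons fun_upd_same)
  also have "\<dots> = (\<Sum>y\<in>A i. \<Sum>g\<in>PiE (set L) A. u i y (?path g))"
    unfolding path_upd by (simp add: sum.cartesian_product)
  also have "\<dots> = (\<Sum>y\<in>A i. u i y (\<Sum>g\<in>PiE (set L) A. ?path g))"
    by (simp add: op_sum)
  also have "\<dots> = foldr (\<lambda>i v. \<Sum>l\<in>A i. u i l v) (i # L) v"
    using Cons by simp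
  finally show ?case .
qed simp

lemma foldr_row_sum:
  assumes "\<And>i. i \<in> set L \<Longrightarrow> A i = UNIV" and "v \<in> K"
  shows "foldr (\<lambda>i v. \<Sum>l\<in>A i. u i l v) L v = v"
  using assms(1) by (induction L) (simp_all add: row_sum assms(2))

definition commuting :: "('v \<times> 'v) set \<Rightarrow> bool" where
  "commuting S \<longleftrightarrow> (\<forall>(i, l)\<in>S. \<forall>(j, k)\<in>S. \<forall>v\<in>K. u i l (u j k v) = u j k (u i l v))"

lemma commutingD:
  "commuting S \<Longrightarrow> (i, l) \<in> S \<Longrightarrow> (j, k) \<in> S \<Longrightarrow> v \<in> K \<Longrightarrow> u i l (u j k v) = u j k (u i l v)"
  unfolding commuting_def by blast

lemma commuting_subset: "commuting S \<Longrightarrow> T \<subseteq> S \<Longrightarrow> commuting T"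
  unfolding commuting_def by blast

lemma op_path_op_commute:
  assumes "commuting (insert (i, l) (set ps))" and "v \<in> K"
  shows "u i l (path_op ps v) = path_op ps (u i l v)"
  using assms(1)
proof (induction ps)
  case (Cons p ps)
  obtain j k where p: "p = (j, k)"
    by (cases p)
  have "u i l (u j k (path_op ps v)) = u j k (u i l (path_op ps v))"
    using Cons.prems assms(2) by (intro commutingD[of "insert (i, l) (set (p # ps))"]) (auto simp: p)
  moreover have "commuting (insert (i, l) (set ps))"
    using Cons.prems by (rule commuting_subset) auto
  ultimately show ?case
    using Cons.IH by (simp add: p)
qed simp

lemma path_op_selfadj:
  assumes "commuting (set ps)" and "v \<in> K" "w \<in> K"
  shows "cinner (path_op ps v) w = cinner v (path_op ps w)"
  using assms(1,3)
proof (induction ps arbitrary: w)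
  case (Cons p ps)
  obtain j k where p: "p = (j, k)"
    by (cases p)
  have "commuting (set ps)"
    using Cons.prems(1) by (rule commuting_subset) auto
  then show ?case
    using Cons op_path_op_commute[of j k ps w] by (simp add: p op_selfadj)
qed simp

lemma path_op_idem:
  assumes "commuting (set ps)" and "v \<in> K"
  shows "path_op ps (path_op ps v) = path_op ps v"
  using assms(1)
proof (induction ps)
  case (Cons p ps)
  obtain j k where p: "p = (j, k)"
    by (cases p)
  have "commuting (set ps)"
    using Cons.prems(1) by (rule commuting_subset) auto
  then have "path_op ps (u j k (path_op ps v)) = u j k (path_op ps v)"
    using Cons op_path_op_commute[of j k ps "path_op ps v"] assms(2) by (simp add: p)
  then show ?case
    using assms(2) by (simp add: p op_idem)
qed simp

text \<open>In a commuting product of projections, a repeated factor can be moved next to its twin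
  and merged with it.\<close>

lemma op_path_op_absorb:
  assumes "commuting (set ps)" and "(i, l) \<in> set ps" and "v \<in> K"
  shows "u i l (path_op ps v) = path_op ps v" "path_op ps (u i l v) = path_op ps v"
proof -
  show *: "u i l (path_op ps v) = path_op ps v"
    using assms(1,2)
  proof (induction ps)
    case (Cons p ps)
    obtain j k where p: "p = (j, k)"
      by (cases p)
    show ?case
    proof (cases "(i, l) = (j, k)")
      case True
      then show ?thesis
        using assms(3) by (simp add: p op_idem)
    next
      case False
      have "commuting (set ps)"
        using Cons.prems(1) by (rule commuting_subset) auto
      moreover have "u i l (u j k (path_op ps v)) = u j k (u i l (path_op ps v))"
        using Cons.prems assms(3) by (intro commutingD[of "set (p # ps)"]) (auto simp: p)
      ultimately show ?thesis
        using False Cons by (auto simp: p)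
    qed
  qed simp
  have "commuting (insert (i, l) (set ps))"
    using assms(1,2) by (simp add: insert_absorb)
  from op_path_op_commute[OF this assms(3)] * show "path_op ps (u i l v) = path_op ps v"
    by simp
qed

end

text \<open>The trace condition moves a single generator; \<open>trace_append\<close> iterates it to
  full cyclicity.\<close>

locale tracial_qut_representation = qut_representation E K u
  for E :: "'v::finite \<Rightarrow> 'v \<Rightarrow> bool"
    and K :: "'h::complex_hilbert set" and u :: "'v \<Rightarrow> 'v \<Rightarrow> 'h \<Rightarrow> 'h" +
  fixes \<psi> :: 'h
  assumes state_mem [simp]: "\<psi> \<in> K" and norm_state: "norm \<psi> = 1"
    and trace: "cinner \<psi> (u i l (path_op ps \<psi>)) = cinner \<psi> (path_op ps (u i l \<psi>))"
begin

lemma trace_append: "cinner \<psi> (path_op (ps @ qs) \<psi>) = cinner \<psi> (path_op (qs @ ps) \<psi>)"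
proof (induction ps arbitrary: qs)
  case (Cons p ps)
  obtain i l where p: "p = (i, l)"
    by (cases p)
  show ?case
    using Cons[of "qs @ [p]"] trace[of i l "ps @ qs"] by (simp add: p)
qed simp

text \<open>For projections P and Q, which may fail to commute with each other, the trace of PQ
  equals that of PPQ and hence that of PQP, which is the squared norm of QP at the state.\<close>

lemma trace_path_op_nonneg:
  assumes "commuting (set ps)" "commuting (set qs)"
  shows "cinner \<psi> (path_op (ps @ qs) \<psi>) =
    complex_of_real ((norm (path_op qs (path_op ps \<psi>)))\<^sup>2)"
proof -
  have "cinner \<psi> (path_op (ps @ qs) \<psi>) = cinner \<psi> (path_op (ps @ (ps @ qs)) \<psi>)"
    using assms by (simp add: path_op_idem)
  also have "\<dots> = cinner \<psi> (path_op ps (path_op qs (path_op ps \<psi>)))"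
    using trace_append[of ps "ps @ qs"] by simp
  also have "\<dots> = cinner (path_op ps \<psi>) (path_op qs (path_op qs (path_op ps \<psi>)))"
    using assms by (simp add: path_op_selfadj path_op_idem)
  also have "\<dots> = cinner (path_op qs (path_op ps \<psi>)) (path_op qs (path_op ps \<psi>))"
    using assms by (simp add: path_op_selfadj)
  finally show ?thesis
    by (simp only: cinner_self)
qed

text \<open>Every question other than \<open>i\<close> and \<open>j\<close> is summed out by its row
  relation, leaving the two prescribed factors.\<close>

lemma sum_trace_paths:
  assumes L: "distinct L" "set L = UNIV"
    and real: "cinner \<psi> (u i l (u j k \<psi>)) \<in> \<real>"
  shows "(\<Sum>\<sigma> | \<sigma> i = l \<and> \<sigma> j = k. cinner \<psi> (path_op (map (\<lambda>i. (i, \<sigma> i)) L) \<psi>)) =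
    cinner \<psi> (u i l (u j k \<psi>))"
proof -
  \<comment> \<open>The answers allowed at \<open>t\<close>. If \<open>i = j\<close>, both
    constraints act on one vertex, and the set is empty there unless \<open>l = k\<close>.\<close>
  define A where "A t = {y. (t = i \<longrightarrow> y = l) \<and> (t = j \<longrightarrow> y = k)}" for t
  let ?step = "\<lambda>t v. \<Sum>y\<in>A t. u t y v"
  have A: "A t = UNIV" if "t \<noteq> i" "t \<noteq> j" for t
    using that by (simp add: A_def)
  have "{\<sigma>. \<sigma> i = l \<and> \<sigma> j = k} = PiE (set L) A"
    unfolding L PiE_UNIV_domain by (simp add: A_def Pi_def all_conj_distrib)
  then have sum: "(\<Sum>\<sigma> | \<sigma> i = l \<and> \<sigma> j = k. cinner \<psi> (path_op (map (\<lambda>i. (i, \<sigma> i)) L) \<psi>)) =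
      cinner \<psi> (foldr ?step L \<psi>)"
    by (simp only: sum_path_op[OF L(1), symmetric] cinner_sum_right)
  \<comment> \<open>The list may contain \<open>j\<close> before \<open>i\<close>; reality of the
    value makes the order of the two factors irrelevant.\<close>
  have "cinner (u i l (u j k \<psi>)) \<psi> = cinner \<psi> (u i l (u j k \<psi>))"
    by (subst cinner_commute) (use real in \<open>simp add: Reals_cnj_iff\<close>)
  then have swap: "cinner \<psi> (u j k (u i l \<psi>)) = cinner \<psi> (u i l (u j k \<psi>))"
    by (simp add: op_selfadj)
  show ?thesis
  proof (cases "i = j")
    case True
    obtain as bs where split: "L = as @ i # bs"
      using split_list[of i L] L(2) by auto
    have "foldr ?step bs \<psi> = \<psi>" "v \<in> K \<Longrightarrow> foldr ?step as v = v" for v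
      using L(1) True unfolding split by (auto intro!: foldr_row_sum A)
    moreover have "A i = (if l = k then {l} else {})"
      using True by (auto simp: A_def)
    moreover have "u i l (u j k \<psi>) = (if l = k then u i l \<psi> else 0)"
      using True op_orth[of \<psi> i i l k] by (auto simp: op_idem vrel_def)
    ultimately show ?thesis
      unfolding sum by (simp add: split zero_mem)
  next
    case False
    have *: "foldr ?step L \<psi> = ?step s (?step t \<psi>)"
      if split: "L = as @ s # bs @ t # cs" and st: "{s, t} = {i, j}" for s t as bs cs
    proof -
      have "r \<noteq> i \<and> r \<noteq> j" if "r \<in> set as \<union> set bs \<union> set cs" for r
        using L(1) st that unfolding split by (auto simp: doubleton_eq_iff)
      then have id: "foldr ?step as v = v" "foldr ?step bs v = v" "foldr ?step cs v = v"
        if "v \<in> K" for v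
        using that by (auto intro!: foldr_row_sum A)
      have "?step r v \<in> K" if "v \<in> K" for r v
        using that by (auto intro: sum_mem)
      then show ?thesis
        by (simp add: split id)
    qed
    have step: "?step i v = u i l v" "?step j v = u j k v" for v
      using False by (simp_all add: A_def)
    obtain as bs where split: "L = as @ i # bs"
      using split_list[of i L] L(2) by auto
    have "j \<in> set as \<or> j \<in> set bs"
      using False L(2) unfolding split by auto
    then show ?thesis
    proof
      assume "j \<in> set bs"
      then obtain cs ds where "bs = cs @ j # ds"
        using split_list by metis
      then show ?thesis
        unfolding sum using *[of as i cs j ds] by (simp add: split step)
    next
      assume "j \<in> set as"
      then obtain cs ds where "as = cs @ j # ds"
        using split_list by metis
      then show ?thesis
        unfolding sum using *[of cs j ds i bs] by (simp add: split step swap insert_commute)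
    qed
  qed
qed

text \<open>
  The convex coefficient of \<open>\<sigma>\<close> is the trace of the product of all \<open>u i (\<sigma> i)\<close>, which is
  nonnegative because it is the trace of a product of two projections.
\<close>

theorem winning_classical_of_commuting_halves:
  fixes xs ys :: "'v list"
  assumes simple: "simple_graph E"
    and L: "distinct (xs @ ys)" "set (xs @ ys) = UNIV"
    and xs: "commuting (set xs \<times> UNIV)" and ys: "commuting (set ys \<times> UNIV)"
    and p: "\<And>l k i j. complex_of_real (p l k i j) = cinner \<psi> (u i l (u j k \<psi>))"
  shows "winning_classical E p"
proof -
  define X where "X \<sigma> = map (\<lambda>i. (i, \<sigma> i)) xs" for \<sigma> :: "'v \<Rightarrow> 'v"
  define Y where "Y \<sigma> = map (\<lambda>i. (i, \<sigma> i)) ys" for \<sigma> :: "'v \<Rightarrow> 'v"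
  define c where "c \<sigma> = (norm (path_op (Y \<sigma>) (path_op (X \<sigma>) \<psi>)))\<^sup>2" for \<sigma>
  have comm: "commuting (set (X \<sigma>))" "commuting (set (Y \<sigma>))" for \<sigma>
    by (rule commuting_subset[OF xs], force simp: X_def)
      (rule commuting_subset[OF ys], force simp: Y_def)
  have c: "complex_of_real (c \<sigma>) = cinner \<psi> (path_op (map (\<lambda>i. (i, \<sigma> i)) (xs @ ys)) \<psi>)" for \<sigma>
    unfolding c_def trace_path_op_nonneg[OF comm, symmetric] by (simp add: X_def Y_def)
  have real: "cinner \<psi> (u i l (u j k \<psi>)) \<in> \<real>" for i l j k
    by (metis p Reals_of_real)
  have p_sum: "(\<Sum>\<sigma> | \<sigma> i = l \<and> \<sigma> j = k. c \<sigma>) = p l k i j" for l k i j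
  proof -
    have "complex_of_real (\<Sum>\<sigma> | \<sigma> i = l \<and> \<sigma> j = k. c \<sigma>) = complex_of_real (p l k i j)"
      unfolding of_real_sum c p by (rule sum_trace_paths[OF L real])
    then show ?thesis
      by (simp only: of_real_eq_iff)
  qed
  have c_sum: "sum c UNIV = 1"
  proof -
    have "complex_of_real (sum c UNIV) =
        (\<Sum>\<sigma>\<in>PiE (set (xs @ ys)) (\<lambda>_. UNIV). cinner \<psi> (path_op (map (\<lambda>i. (i, \<sigma> i)) (xs @ ys)) \<psi>))"
      unfolding L PiE_UNIV_domain by (simp add: c)
    also have "\<dots> = cinner \<psi> \<psi>"
      unfolding cinner_sum_right[symmetric] sum_path_op[OF L(1)] by (subst foldr_row_sum) auto
    also have "\<dots> = complex_of_real 1"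
      by (simp add: cinner_self norm_state)
    finally show ?thesis
      by (simp only: of_real_eq_iff)
  qed
  \<comment> \<open>A map that is not an automorphism changes the relation of some pair, and the two
    factors belonging to that pair are orthogonal.\<close>
  have c_zero: "c \<sigma> = 0" if "\<sigma> \<notin> graph_aut E" for \<sigma>
  proof -
    have "\<exists>i j. vrel E i j \<noteq> vrel E (\<sigma> i) (\<sigma> j)"
    proof (rule ccontr)
      assume "\<not> ?thesis"
      then have vrel: "vrel E i j = vrel E (\<sigma> i) (\<sigma> j)" for i j
        by auto
      have "inj \<sigma>"
        by (rule injI) (metis vrel vrel_def vertex_rel.distinct)
      then have "bij \<sigma>"
        by (simp add: bij_def finite_UNIV_inj_surj)
      moreover have "E i j \<longleftrightarrow> vrel E i j = Adjacent" for i j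
        using simple by (auto simp: vrel_def simple_graph_def irreflp_def)
      then have "E (\<sigma> i) (\<sigma> j) \<longleftrightarrow> E i j" for i j
        using vrel by simp
      ultimately show False
        using that by (simp add: graph_aut_def)
    qed
    then obtain i j where ij: "vrel E i j \<noteq> vrel E (\<sigma> i) (\<sigma> j)"
      by blast
    have sym: "vrel E a b = vrel E b a" for a b
      using simple by (auto simp: vrel_def simple_graph_def symp_def)
    have zero: "u i (\<sigma> i) (u j (\<sigma> j) v) = 0" "u j (\<sigma> j) (u i (\<sigma> i) v) = 0" if "v \<in> K" for v
      using that ij sym by (metis op_orth)+
    have absX: "path_op (X \<sigma>) (u s (\<sigma> s) v) = path_op (X \<sigma>) v" if "s \<in> set xs" "v \<in> K" for s v
      using that by (intro op_path_op_absorb comm) (auto simp: X_def)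
    have absY: "u s (\<sigma> s) (path_op (Y \<sigma>) \<psi>) = path_op (Y \<sigma>) \<psi>" if "s \<in> set ys" for s
      using that by (intro op_path_op_absorb comm) (auto simp: Y_def)
    \<comment> \<open>Each half absorbs its own factors, so the two orthogonal factors can be placed
      side by side: at the right end of \<open>X \<sigma>\<close>, at the left end of
      \<open>Y \<sigma>\<close>, or one at each where the halves meet.\<close>
    consider "i \<in> set xs" "j \<in> set xs" | "i \<in> set ys" "j \<in> set ys"
      | "i \<in> set xs" "j \<in> set ys" | "i \<in> set ys" "j \<in> set xs"
      using L(2) by auto
    then have "path_op (X \<sigma>) (path_op (Y \<sigma>) \<psi>) = 0"
    proof cases
      case 1
      then have "path_op (X \<sigma>) (u i (\<sigma> i) (u j (\<sigma> j) (path_op (Y \<sigma>) \<psi>))) =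
          path_op (X \<sigma>) (path_op (Y \<sigma>) \<psi>)"
        by (simp add: absX)
      then show ?thesis
        by (simp add: zero)
    next
      case 2
      then have "u i (\<sigma> i) (u j (\<sigma> j) (path_op (Y \<sigma>) \<psi>)) = path_op (Y \<sigma>) \<psi>"
        by (simp add: absY)
      then show ?thesis
        by (simp add: zero)
    next
      case 3
      then have "path_op (X \<sigma>) (u i (\<sigma> i) (u j (\<sigma> j) (path_op (Y \<sigma>) \<psi>))) =
          path_op (X \<sigma>) (path_op (Y \<sigma>) \<psi>)"
        by (simp add: absX absY)
      then show ?thesis
        by (simp add: zero)
    next
      case 4
      then have "path_op (X \<sigma>) (u j (\<sigma> j) (u i (\<sigma> i) (path_op (Y \<sigma>) \<psi>))) =
          path_op (X \<sigma>) (path_op (Y \<sigma>) \<psi>)"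
        by (simp add: absX absY)
      then show ?thesis
        by (simp add: zero)
    qed
    then have "complex_of_real (c \<sigma>) = 0"
      unfolding c by (simp add: X_def Y_def)
    then show ?thesis
      by simp
  qed
  show ?thesis
    unfolding winning_classical_def
  proof (intro exI[of _ c] conjI ballI allI)
    show "0 \<le> c \<pi>" for \<pi>
      by (simp add: c_def)
    show "sum c (graph_aut E) = 1"
      using c_sum c_zero by (subst sum.mono_neutral_left[of UNIV]) auto
    fix l k i j
    have "(\<Sum>\<pi>\<in>graph_aut E. c \<pi> * aut_correlation \<pi> l k i j) =
        (\<Sum>\<pi>\<in>UNIV. c \<pi> * aut_correlation \<pi> l k i j)"
      using c_zero by (intro sum.mono_neutral_left) auto
    also have "\<dots> = (\<Sum>\<sigma> | \<sigma> i = l \<and> \<sigma> j = k. c \<sigma>)"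
      by (rule sum.mono_neutral_cong_right) (auto simp: aut_correlation_def)
    finally show "p l k i j = (\<Sum>\<pi>\<in>graph_aut E. c \<pi> * aut_correlation \<pi> l k i j)"
      by (simp add: p_sum)
  qed
qed

end

section \<open>Winning strategies\<close>

lemma positive_operator_add: "positive_operator T \<Longrightarrow> T (x + y) = T x + T y"
  by (simp add: positive_operator_def bounded_operator_def linear_add bounded_linear.linear)

lemma positive_operator_cscale: "positive_operator T \<Longrightarrow> T (cscale c x) = cscale c (T x)"
  by (simp add: positive_operator_def bounded_operator_def)

lemma positive_operator_real:
  "positive_operator T \<Longrightarrow> Im (cinner x (T x)) = 0" "positive_operator T \<Longrightarrow> 0 \<le> Re (cinner x (T x))"
  by (simp_all add: positive_operator_def complex_nonneg_Reals_iff)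

text \<open>Polarization: reality of the form at \<open>x + y\<close> compares imaginary parts, and
  at \<open>x + cscale \<i> y\<close> real parts.\<close>

lemma positive_operator_selfadj:
  assumes T: "positive_operator T"
  shows "cinner (T x) y = cinner x (T y)"
proof -
  note lin = positive_operator_add[OF T] positive_operator_cscale[OF T]
    cinner_add_left cinner_add_right cinner_cscale_left cinner_cscale_right
  have "Im (cinner x (T y)) + Im (cinner y (T x)) = 0"
    using positive_operator_real(1)[OF T, of "x + y"] positive_operator_real(1)[OF T, of x]
      positive_operator_real(1)[OF T, of y] by (simp add: lin)
  moreover have "Re (cinner x (T y)) = Re (cinner y (T x))"
    using positive_operator_real(1)[OF T, of "x + cscale \<i> y"] positive_operator_real(1)[OF T, of x]
      positive_operator_real(1)[OF T, of y] by (simp add: lin)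
  ultimately have "cinner x (T y) = cnj (cinner y (T x))"
    by (simp add: complex_eq_iff)
  then show ?thesis
    by (metis cinner_commute)
qed

text \<open>The inequality \<open>T\<^sup>2 \<le> T\<close> comes from evaluating the form of \<open>T\<close> at \<open>x - T x\<close>.\<close>

lemma norm_sq_le_form:
  fixes T :: "'h::complex_hilbert \<Rightarrow> 'h"
  assumes diff: "\<And>x y. T (x - y) = T x - T y"
    and selfadj: "\<And>x y. cinner (T x) y = cinner x (T y)"
    and nonneg: "\<And>x. 0 \<le> Re (cinner x (T x))"
    and le: "\<And>x. Re (cinner x (T x)) \<le> Re (cinner x x)"
  shows "Re (cinner (T x) (T x)) \<le> Re (cinner x (T x))"
  using nonneg[of "x - T x"] le[of "T x"] selfadj[of x "T x"]
  by (simp add: diff cinner_diff_left cinner_diff_right)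

lemma Re_cinner_self_le_0: "Re (cinner x x) \<le> 0 \<Longrightarrow> x = 0" for x :: "'h::complex_hilbert"
  by (simp add: cinner_self)

locale povm =
  fixes M :: "'v::finite \<Rightarrow> 'v \<Rightarrow> 'h::complex_hilbert \<Rightarrow> 'h"
  assumes pos: "positive_operator (M i l)"
    and sum_eq: "(\<Sum>l\<in>UNIV. M i l x) = x"
begin

lemmas add = positive_operator_add[OF pos]
  and cscale = positive_operator_cscale[OF pos]
  and selfadj = positive_operator_selfadj[OF pos]
  and nonneg = positive_operator_real(2)[OF pos]

lemma zero [simp]: "M i l 0 = 0"
  using add[of i l 0 0] by simp

lemma diff: "M i l (x - y) = M i l x - M i l y"
  using add[of i l "x - y" y] by simp

lemma sum: "M i l (\<Sum>a\<in>A. f a) = (\<Sum>a\<in>A. M i l (f a))"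
  by (induction A rule: infinite_finite_induct) (simp_all add: add)

lemma le: "Re (cinner x (M i l x)) \<le> Re (cinner x x)"
proof -
  have "Re (cinner x (M i l x)) \<le> (\<Sum>l\<in>UNIV. Re (cinner x (M i l x)))"
    by (intro member_le_sum) (auto intro: nonneg)
  also have "\<dots> = Re (cinner x (\<Sum>l\<in>UNIV. M i l x))"
    by (simp add: cinner_sum_right)
  finally show ?thesis
    by (simp add: sum_eq)
qed

lemma sq_le: "Re (cinner (M i l x) (M i l x)) \<le> Re (cinner x (M i l x))"
  by (rule norm_sq_le_form) (auto intro: diff selfadj nonneg le)

text \<open>The operator \<open>M i l\<close> minus its square again has form values between zero
  and the squared norm. So \<open>norm_sq_le_form\<close> applies to it, and a zero of its form is a
  zero of the operator.\<close>

lemma idem_if_form_eq: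
  assumes "Re (cinner x (M i l x)) = Re (cinner (M i l x) (M i l x))"
  shows "M i l (M i l x) = M i l x"
proof -
  define T where "T y = M i l y - M i l (M i l y)" for y
  have form: "Re (cinner y (T y)) = Re (cinner y (M i l y)) - Re (cinner (M i l y) (M i l y))" for y
    by (simp add: T_def cinner_diff_right selfadj)
  have "Re (cinner (T x) (T x)) \<le> Re (cinner x (T x))"
  proof (rule norm_sq_le_form)
    show "Re (cinner y (T y)) \<le> Re (cinner y y)" for y
      using le[of y i l] unfolding form cinner_self[of "M i l y"] Re_complex_of_real
      using zero_le_power2[of "norm (M i l y)"] by linarith
  qed (auto simp: form sq_le, auto simp: T_def diff selfadj cinner_diff_left cinner_diff_right)
  then have "T x = 0"
    using assms by (intro Re_cinner_self_le_0) (simp add: form)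
  then show ?thesis
    by (simp add: T_def)
qed

end

locale winning_strategy = M: povm M + N: povm N
  for M N :: "'v::finite \<Rightarrow> 'v \<Rightarrow> 'h::complex_hilbert \<Rightarrow> 'h" +
  fixes E :: "'v \<Rightarrow> 'v \<Rightarrow> bool" and \<psi> :: 'h and p :: "'v correlation"
  assumes norm_state: "norm \<psi> = 1"
    and commute: "M i l (N j k x) = N j k (M i l x)"
    and corr: "complex_of_real (p l k i j) = cinner \<psi> (M i l (N j k \<psi>))"
    and winning: "winning E p"
begin

section \<open>Relations satisfied at the state\<close>

lemma losing: "vrel E i j \<noteq> vrel E l k \<Longrightarrow> cinner \<psi> (M i l (N j k \<psi>)) = 0"
  using winning by (simp add: winning_def flip: corr)

lemma same_question: "l \<noteq> k \<Longrightarrow> cinner \<psi> (M i l (N i k \<psi>)) = 0"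
  by (rule losing) (simp add: vrel_def)

text \<open>Insert the sum of all \<open>N i k\<close>; equal questions force equal answers, so one
  term remains.\<close>

lemma cinner_M_state: "cinner \<psi> (M i l \<psi>) = cinner \<psi> (M i l (N i l \<psi>))"
proof -
  have "cinner \<psi> (M i l \<psi>) = cinner \<psi> (M i l (\<Sum>k\<in>UNIV. N i k \<psi>))"
    by (simp only: N.sum_eq)
  also have "\<dots> = (\<Sum>k\<in>UNIV. cinner \<psi> (M i l (N i k \<psi>)))"
    by (simp only: M.sum cinner_sum_right)
  also have "\<dots> = (\<Sum>k\<in>UNIV. if k = l then cinner \<psi> (M i l (N i l \<psi>)) else 0)"
    by (intro sum.cong) (auto simp: same_question)
  finally show ?thesis
    by simp
qed

lemma sum_form_M: "(\<Sum>l\<in>UNIV. Re (cinner x (M i l x))) = Re (cinner x x)"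
  by (simp add: M.sum_eq flip: Re_sum cinner_sum_right)

lemma sum_form_N: "(\<Sum>l\<in>UNIV. Re (cinner x (N i l x))) = Re (cinner x x)"
  by (simp add: N.sum_eq flip: Re_sum cinner_sum_right)

text \<open>The squared distance is at most the form of \<open>N i l\<close> minus that of
  \<open>M i l\<close> at the state. These differences sum to zero over \<open>l\<close>, so every
  distance vanishes.\<close>

lemma M_state_eq_N_state: "M i l \<psi> = N i l \<psi>"
proof -
  let ?d = "\<lambda>l. M i l \<psi> - N i l \<psi>"
  have le: "Re (cinner (?d l) (?d l)) \<le>
      Re (cinner \<psi> (M i l \<psi>)) + Re (cinner \<psi> (N i l \<psi>)) - 2 * Re (cinner \<psi> (M i l \<psi>))" for l
  proof -
    have "Re (cinner (M i l \<psi>) (N i l \<psi>)) = Re (cinner \<psi> (M i l \<psi>))"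
      by (simp add: M.selfadj cinner_M_state)
    moreover from this have "Re (cinner (N i l \<psi>) (M i l \<psi>)) = Re (cinner \<psi> (M i l \<psi>))"
      by (simp add: Re_cinner_commute)
    ultimately show ?thesis
      using M.sq_le[of i l \<psi>] N.sq_le[of i l \<psi>]
      by (simp add: cinner_diff_left cinner_diff_right)
  qed
  have "Re (cinner (?d l) (?d l)) \<le> (\<Sum>l\<in>UNIV. Re (cinner (?d l) (?d l)))"
    by (intro member_le_sum) (auto simp: cinner_self)
  also have "\<dots> \<le> (\<Sum>l\<in>UNIV. Re (cinner \<psi> (M i l \<psi>)) + Re (cinner \<psi> (N i l \<psi>))
      - 2 * Re (cinner \<psi> (M i l \<psi>)))"
    by (intro sum_mono le)
  also have "\<dots> = 0"
    by (simp only: sum.distrib sum_subtractf sum_form_M sum_form_N sum_distrib_left[symmetric])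
  finally have "?d l = 0"
    by (rule Re_cinner_self_le_0)
  then show ?thesis
    by simp
qed

text \<open>Replacing \<open>N i l\<close> by \<open>M i l\<close> at the state in
  \<open>cinner_M_state\<close> gives the criterion of \<open>idem_if_form_eq\<close>.\<close>

lemma M_idem_state: "M i l (M i l \<psi>) = M i l \<psi>"
  by (rule M.idem_if_form_eq)
    (subst cinner_M_state, simp add: M.selfadj flip: M_state_eq_N_state)

text \<open>Exchanging \<open>M j k\<close> for \<open>N j k\<close> at the state and using
  commutation reduces the squared norm of this vector to a losing probability.\<close>

lemma M_orth_state:
  assumes "vrel E i j \<noteq> vrel E l k"
  shows "M i l (M j k \<psi>) = 0"
proof -
  let ?w = "M i l (M j k \<psi>)"
  have "M i l ?w = N j k (M i l (M i l \<psi>))"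
    by (simp add: M_state_eq_N_state[of j k] commute)
  also have "\<dots> = ?w"
    by (simp add: M_idem_state M_state_eq_N_state[of j k] commute)
  finally have "cinner ?w ?w = cinner (N j k \<psi>) ?w"
    by (simp add: M.selfadj flip: M_state_eq_N_state)
  also have "\<dots> = cinner \<psi> (M i l (N j k (M j k \<psi>)))"
    by (simp add: N.selfadj commute)
  also have "N j k (M j k \<psi>) = N j k \<psi>"
    using M_idem_state[of j k] by (simp add: M_state_eq_N_state commute)
  finally show ?thesis
    using losing[OF assms] by simp
qed

text \<open>A counting argument: orthogonality makes the squared defect of column \<open>l\<close>
  equal to one minus its form. Summed over \<open>l\<close>, the forms give the number of vertices
  by the row sums, so all defects vanish.\<close>

lemma M_col_state: "(\<Sum>i\<in>UNIV. M i l \<psi>) = \<psi>"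
proof -
  let ?q = "\<lambda>l. \<Sum>i\<in>UNIV. M i l \<psi>"
  have "cinner (?q l) (?q l) = cinner \<psi> (?q l)" for l
  proof -
    have "cinner (?q l) (?q l) = (\<Sum>i\<in>UNIV. \<Sum>j\<in>UNIV. cinner \<psi> (M i l (M j l \<psi>)))"
      by (simp add: cinner_sum_left cinner_sum_right M.selfadj) (rule sum.swap)
    also have "\<dots> = (\<Sum>i\<in>UNIV. \<Sum>j\<in>UNIV. if j = i then cinner \<psi> (M i l \<psi>) else 0)"
      using M_orth_state[of _ _ l l] by (intro sum.cong refl) (auto simp: M_idem_state vrel_def)
    finally show ?thesis
      by (simp add: cinner_sum_right)
  qed
  then have form: "Re (cinner (\<psi> - ?q l) (\<psi> - ?q l)) = 1 - Re (cinner \<psi> (?q l))" for l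
    using norm_state Re_cinner_commute[of "?q l" \<psi>]
    by (simp add: cinner_diff_left cinner_diff_right cinner_self[of \<psi>])
  have "(\<Sum>l\<in>UNIV. Re (cinner (\<psi> - ?q l) (\<psi> - ?q l))) = 0"
  proof -
    have "(\<Sum>l\<in>UNIV. Re (cinner \<psi> (?q l))) = (\<Sum>i\<in>UNIV. \<Sum>l\<in>UNIV. Re (cinner \<psi> (M i l \<psi>)))"
      unfolding cinner_sum_right Re_sum by (rule sum.swap)
    then show ?thesis
      using norm_state unfolding form by (simp add: sum_subtractf sum_form_M cinner_self)
  qed
  moreover have "Re (cinner (\<psi> - ?q l) (\<psi> - ?q l)) \<le> (\<Sum>l\<in>UNIV. Re (cinner (\<psi> - ?q l) (\<psi> - ?q l)))"
    by (intro member_le_sum) (auto simp: cinner_self)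
  ultimately have "\<psi> - ?q l = 0"
    by (intro Re_cinner_self_le_0) simp
  then show ?thesis
    by simp
qed

text \<open>
  Relations between the \<open>M i l\<close> that hold at \<open>\<psi>\<close> propagate along the commutant of \<open>M\<close>.  The
  image of \<open>\<psi>\<close> under the commutant is invariant because \<open>M i l \<psi> = N i l \<psi>\<close>.
\<close>

definition commutant :: "('h \<Rightarrow> 'h) set" where
  "commutant = {B. (\<forall>x y. B (x + y) = B x + B y) \<and> (\<forall>c x. B (cscale c x) = cscale c (B x)) \<and>
    (\<forall>i l x. B (M i l x) = M i l (B x))}"

definition state_space :: "'h set" where
  "state_space = {B \<psi> | B. B \<in> commutant}"

lemma state_spaceI: "B \<in> commutant \<Longrightarrow> B \<psi> \<in> state_space"
  unfolding state_space_def by blast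

lemma commutant_sum: "B \<in> commutant \<Longrightarrow> B (sum f A) = (\<Sum>a\<in>A. B (f a))"
proof (induction A rule: infinite_finite_induct)
  case (infinite A)
  then have "B (0 + 0) = B 0 + B 0"
    unfolding commutant_def by blast
  with infinite show ?case by simp
next
  case empty
  then have "B (0 + 0) = B 0 + B 0"
    unfolding commutant_def by blast
  then show ?case by simp
qed (simp add: commutant_def)

sublocale qut_representation E state_space M
proof
  have zero: "(\<lambda>x. 0) \<in> commutant"
    by (simp add: commutant_def)
  show "0 \<in> state_space"
    using state_spaceI[OF zero] by simp
next
  fix v w assume "v \<in> state_space" "w \<in> state_space"
  then obtain A B where AB: "A \<in> commutant" "B \<in> commutant" "v = A \<psi>" "w = B \<psi>"
    unfolding state_space_def by blast
  then have "(\<lambda>x. A x + B x) \<in> commutant"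
    by (simp add: commutant_def M.add cscale_add_right algebra_simps)
  then show "v + w \<in> state_space"
    using state_spaceI AB by fastforce
next
  fix v and c :: complex
  assume "v \<in> state_space"
  then obtain B where B: "B \<in> commutant" "v = B \<psi>"
    unfolding state_space_def by blast
  then have "(\<lambda>x. cscale c (B x)) \<in> commutant"
    by (simp add: commutant_def M.cscale cscale_add_right cscale_cscale mult.commute)
  then show "cscale c v \<in> state_space"
    using state_spaceI B by fastforce
next
  fix v i j
  assume "v \<in> state_space"
  then obtain B where B: "B \<in> commutant" "v = B \<psi>"
    unfolding state_space_def by blast
  then have BM: "B (M i l x) = M i l (B x)" for i l x
    by (simp add: commutant_def)
  \<comment> \<open>This element of the commutant witnesses invariance: \<open>B\<close> commutes
    past \<open>M i j\<close>, which acts as \<open>N i j\<close> on the state.\<close>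
  have "(\<lambda>x. B (N i j x)) \<in> commutant"
    using B(1) by (simp add: commutant_def N.add N.cscale flip: commute)
  moreover have "M i j v = B (N i j \<psi>)"
    by (simp add: B(2) flip: BM M_state_eq_N_state)
  ultimately show "M i j v \<in> state_space"
    using state_spaceI by fastforce
  show "M i j (M i j v) = M i j v"
    by (simp add: B(2) M_idem_state flip: BM)
  show "(\<Sum>j\<in>UNIV. M i j v) = v"
    by (rule M.sum_eq)
  show "(\<Sum>i\<in>UNIV. M i j v) = v"
    by (simp add: B(2) M_col_state flip: BM commutant_sum[OF B(1)])
next
  fix v i j l k
  assume "v \<in> state_space" and rel: "vrel E i j \<noteq> vrel E l k"
  then obtain B where B: "B \<in> commutant" "v = B \<psi>"
    unfolding state_space_def by blast
  then have BM: "B (M i l x) = M i l (B x)" for i l x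
    by (simp add: commutant_def)
  have "B 0 = 0"
    using commutant_sum[OF B(1), of id "{}"] by simp
  then show "M i l (M j k v) = 0"
    by (simp add: B(2) M_orth_state[OF rel] flip: BM)
qed (simp_all add: M.add M.cscale M.selfadj)

lemma path_op_N_commute: "path_op ps (N j k x) = N j k (path_op ps x)"
  by (induction ps) (auto simp: commute)

sublocale tracial_qut_representation E state_space M \<psi>
proof
  have "id \<in> commutant"
    by (simp add: commutant_def)
  then show "\<psi> \<in> state_space"
    using state_spaceI by fastforce
  show "norm \<psi> = 1"
    by (rule norm_state)
  show "cinner \<psi> (M i l (path_op ps \<psi>)) = cinner \<psi> (path_op ps (M i l \<psi>))" for i l ps
  proof -
    \<comment> \<open>The last factor is exchanged for \<open>N i l\<close>, which commutes past the
      product, moves to the other side of the inner product, and becomes \<open>M i l\<close>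
      again.\<close>
    have "cinner \<psi> (path_op ps (M i l \<psi>)) = cinner (N i l \<psi>) (path_op ps \<psi>)"
      by (simp add: M_state_eq_N_state path_op_N_commute N.selfadj)
    also have "\<dots> = cinner \<psi> (M i l (path_op ps \<psi>))"
      by (simp add: M.selfadj flip: M_state_eq_N_state)
    finally show ?thesis ..
  qed
qed

lemma corr_M: "complex_of_real (p l k i j) = cinner \<psi> (M i l (M j k \<psi>))"
  by (simp add: corr M_state_eq_N_state[of j k])

end

section \<open>Assembling the result for two copies\<close>

lemma simple_graph_two_copies: "simple_graph G \<Longrightarrow> simple_graph (two_copies G)"
proof -
  assume G: "simple_graph G"
  have "\<exists>b y. z = copy b y" for z :: "'a + 'a"
    by (metis copy.simps sum.exhaust)
  with G show ?thesis
    unfolding simple_graph_def symp_def irreflp_def by (metis two_copies_copy)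
qed

theorem proposition5p9:
  fixes G :: "'v::finite \<Rightarrow> 'v \<Rightarrow> bool"
  assumes "simple_graph G"
    and "connected_graph G"
    and "no_quantum_symmetry G"
  shows "\<not> nonlocal_symmetry_on TYPE('h::complex_hilbert) (two_copies G)"
proof -
  have "winning_classical (two_copies G) p"
    if quantum: "quantum_correlation TYPE('h) p" and win: "winning (two_copies G) p" for p
  proof -
    obtain \<psi> :: 'h and M N where
      strategy: "norm \<psi> = 1" "\<And>i l. positive_operator (M i l)" "\<And>j k. positive_operator (N j k)"
        "\<And>i x. (\<Sum>l\<in>UNIV. M i l x) = x" "\<And>j x. (\<Sum>k\<in>UNIV. N j k x) = x"
        "\<And>i l j k. M i l \<circ> N j k = N j k \<circ> M i l"
        "\<And>l k i j. complex_of_real (p l k i j) = cinner \<psi> (M i l (N j k \<psi>))"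
      using quantum unfolding quantum_correlation_def by blast
    interpret winning_strategy M N "two_copies G" \<psi> p
      using strategy win by unfold_locales (auto simp: fun_eq_iff)
    interpret two_copies_representation G state_space M
      using assms by unfold_locales
    obtain vs :: "'v list" where vs: "set vs = UNIV" "distinct vs"
      using finite_distinct_list[of "UNIV :: 'v set"] by auto
    \<comment> \<open>Listing the vertices copy by copy makes the two commuting halves the two
      copies.\<close>
    let ?L = "\<lambda>b. map (copy b) vs"
    have comm: "commuting (set (?L b) \<times> UNIV)" for b
      using op_commute_within_copy[OF assms(3)] by (auto simp: commuting_def)
    have "distinct (?L False @ ?L True)"
      using vs by (auto simp: distinct_map inj_on_def simp del: copy.simps)
    moreover have "set (?L False @ ?L True) = UNIV"
    proof -
      have "z \<in> range (copy False) \<union> range (copy True)" for z :: "'v + 'v"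
        by (cases z) (metis copy.simps rangeI UnCI)+
      then show ?thesis
        using vs by auto
    qed
    ultimately show ?thesis
      using winning_classical_of_commuting_halves[OF simple_graph_two_copies[OF assms(1)] _ _
          comm comm corr_M] by blast
  qed
  then show ?thesis
    unfolding nonlocal_symmetry_on_def by blast
qed

end
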